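(* Let $0<p_n<n$ with $p_n=o(n)$, let $b>0$ be fixed, and let $\tau=\tau_n>0$ satisfy $(p_n/n)^K\lesssim\tau\le\frac{p_n}{n}\sqrt{\log(n/p_n)}$ for some constant $K>1$. Consider the scale-mixture-of-normals prior with the inverse-Gaussian mixing density $$\pi(u)=\frac{C_{b,\tau}\,\tau}{u^{3/2}}e^{-\frac{\tau^2}{u}-bu},\quad u>0,\qquad C_{b,\tau}=\frac{e^{2\sqrt b\,\tau}}{\sqrt{\boldsymbol{\pi}}},$$ where $\boldsymbol\pi=3.14\ldots$. Then for every positive sequence $M_n\to\infty$, $$\sup_{\theta_0\in\ell_0[p_n]}\mathbb E_{\theta_0}\Pi\big(\theta:\|\theta-\theta_0\|^2>M_np_n\log(n/p_n)\,\big|\,X^n\big)\to0 \quad\text{and}\quad \sup_{\theta_0\in\ell_0[p_n]}\mathbb E_{\theta_0}\|\widehat\theta-\theta_0\|^2\lesssim p_n\log(n/p_n).$$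
   Context: Model: for each $n$, $X^n=(X_1,\dots,X_n)\sim\mathcal N(\theta_0,I_n)$ with $\theta_0\in\mathbb R^n$; $\mathbb E_{\theta_0}$ is expectation under this law. $\ell_0[p_n]=\{\theta\in\mathbb R^n:\sum_{i=1}^n\mathbf 1\{\theta_i\ne0\}\le p_n\}$. The scale-mixture-of-normals prior with mixing density $\pi$ (a possibly $n$-dependent probability density on $[0,\infty)$): independently for $i=1,\dots,n$, $\theta_i\mid\sigma_i^2\sim\mathcal N(0,\sigma_i^2)$ and $\sigma_i^2\sim\pi$. $\Pi(\cdot\mid X^n)$ is the posterior distribution of $\theta=(\theta_1,\dots,\theta_n)$ when $X^n\mid\theta\sim\mathcal N(\theta,I_n)$, and $\widehat\theta$ is the coordinatewise posterior mean. $\|\cdot\|$ is the Euclidean norm. Limits are as $n\to\infty$; $A_n\lesssim B_n$ means $A_n\le C_0B_n$ for all sufficiently large $n$ with a constant $C_0$ independent of $n$. *)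

theory Defs
  imports "HOL-Probability.Probability"
begin

text \<open>
  Vectors of \<open>\<real>\<^sup>n\<close> are the elements of \<open>{..<n} \<rightarrow>\<^sub>E UNIV\<close>, the space of the product
  measures indexed by \<open>{..<n}\<close>; this allows \<open>n\<close> to vary.
\<close>

text \<open>
  \<open>normal_law m v\<close> is the normal distribution with mean \<open>m\<close> and variance \<open>v\<close>, for \<open>v \<ge> 0\<close>.
  The library's \<open>normal_density\<close> takes the standard deviation and is the zero function when
  that is 0, hence the separate case for the degenerate law.
\<close>

definition normal_law :: "real \<Rightarrow> real \<Rightarrow> real measure" where
  "normal_law m v =
     (if v = 0 then return borel m else density lborel (normal_density m (sqrt v)))"

definition obs_law :: "nat \<Rightarrow> (nat \<Rightarrow> real) \<Rightarrow> (nat \<Rightarrow> real) measure" where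
  "obs_law n \<theta> = PiM {..<n} (\<lambda>i. normal_law (\<theta> i) 1)"

definition likelihood :: "nat \<Rightarrow> (nat \<Rightarrow> real) \<Rightarrow> (nat \<Rightarrow> real) \<Rightarrow> real" where
  "likelihood n \<theta> X = (\<Prod>i<n. normal_density (\<theta> i) 1 (X i))"

text \<open>
  Law of a single coordinate \<open>\<theta>\<^sub>i\<close>: draw the variance \<open>u\<close> from the mixing density \<open>\<pi>\<close>
  (a probability density on the real line vanishing on the negative half-line), then draw
  from the normal law with mean 0 and variance \<open>u\<close>.
\<close>

definition scale_mixture :: "(real \<Rightarrow> real) \<Rightarrow> real measure" where
  "scale_mixture \<pi> = density lborel \<pi> \<bind> (\<lambda>u. normal_law 0 u)"

definition prior :: "nat \<Rightarrow> (real \<Rightarrow> real) \<Rightarrow> (nat \<Rightarrow> real) measure" where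
  "prior n \<pi> = PiM {..<n} (\<lambda>i. scale_mixture \<pi>)"

text \<open>The posterior distribution is given by Bayes' formula, valid as the model is dominated.\<close>

definition posterior ::
    "nat \<Rightarrow> (real \<Rightarrow> real) \<Rightarrow> (nat \<Rightarrow> real) \<Rightarrow> (nat \<Rightarrow> real) measure" where
  "posterior n \<pi> X =
     density (prior n \<pi>)
       (\<lambda>\<theta>. ennreal (likelihood n \<theta> X) / (\<integral>\<^sup>+ \<theta>'. ennreal (likelihood n \<theta>' X) \<partial>prior n \<pi>))"

definition posterior_mean ::
    "nat \<Rightarrow> (real \<Rightarrow> real) \<Rightarrow> (nat \<Rightarrow> real) \<Rightarrow> nat \<Rightarrow> real" where
  "posterior_mean n \<pi> X i = (\<integral> \<theta>. \<theta> i \<partial>posterior n \<pi> X)"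

definition sq_dist :: "nat \<Rightarrow> (nat \<Rightarrow> real) \<Rightarrow> (nat \<Rightarrow> real) \<Rightarrow> real" where
  "sq_dist n \<theta> \<theta>' = (L2_set (\<lambda>i. \<theta> i - \<theta>' i) {..<n})\<^sup>2"

definition sparse_vectors :: "nat \<Rightarrow> real \<Rightarrow> (nat \<Rightarrow> real) set" where
  "sparse_vectors n s =
     {\<theta> \<in> {..<n} \<rightarrow>\<^sub>E UNIV. real (card {i \<in> {..<n}. \<theta> i \<noteq> 0}) \<le> s}"

definition ig_const :: "real \<Rightarrow> real \<Rightarrow> real" where
  "ig_const b \<tau> = exp (2 * sqrt b * \<tau>) / sqrt pi"

definition ig_density :: "real \<Rightarrow> real \<Rightarrow> real \<Rightarrow> real" where
  "ig_density b \<tau> u =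
     (if u > 0 then ig_const b \<tau> * \<tau> / u powr (3/2) * exp (- (\<tau>\<^sup>2 / u) - b * u) else 0)"

end

theory Submission
  imports Defs
begin

text \<open>
  Both claims follow from the single bound
  \<open>\<Sum>\<^sub>i E E[(\<theta>\<^sub>i - \<theta>\<^sub>0\<^sub>i)\<^sup>2 | X] \<le> C p L\<close> with \<open>L = ln (n / p)\<close>, uniformly over the sparse vectors:
  contraction by Markov's inequality (\<open>expected_posterior_tail_le\<close>), the risk of the posterior
  mean by Jensen's (\<open>expected_posterior_mean_loss_le\<close>). As the posterior is a product, the
  summands are one-dimensional risks (\<open>nn_integral_posterior_component\<close>). It remains to bound them by a multiple
  of \<open>\<tau>\<close> for the at most \<open>n\<close> null coordinates, where \<open>n \<tau> \<le> p L\<close>, and by a multiple of \<open>L\<close> for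
  the at most \<open>p\<close> others (\<open>total_risk_le\<close>).

  For a null coordinate, the evidence is at least a constant times the standard normal density,
  since the mixing density has mass of order one near \<open>\<tau>\<^sup>2\<close>. Hence the expected posterior second moment
  is at most a constant times the prior second moment (\<open>risk_at_zero_le\<close>), which is the mean of
  the mixing density and of order \<open>\<tau>\<close> (\<open>ig_mean_le\<close>).

  For an arbitrary coordinate it suffices to bound \<open>E[(\<theta> - x)\<^sup>2 | x]\<close> for every observation \<open>x\<close>. Given the
  variance \<open>u\<close> this is \<open>u / (1 + u) + x\<^sup>2 / (1 + u)\<^sup>2\<close>. Where \<open>u > 1\<close>, integrating the derivative of
  the weighted posterior density of \<open>u\<close> shows that the second term has bounded expectation
  (\<open>by_parts_bound\<close>). Where \<open>u \<le> 1\<close>, the posterior probability of that event is at most of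
  order \<open>exp (- x\<^sup>2 / 12) / \<tau>\<close>, and \<open>\<tau>\<close> is at least polynomial in \<open>p / n\<close>; so \<open>x\<^sup>2\<close> times it is of order
  \<open>L\<close> at most (\<open>small_variance_weight_le\<close>).
\<close>

section \<open>The product structure of the posterior\<close>

text \<open>
  The marginal density at \<open>x\<close> of one observation under the one-dimensional prior \<open>\<nu>\<close>.
\<close>

definition evidence :: "real measure \<Rightarrow> real \<Rightarrow> ennreal" where
  "evidence \<nu> x = (\<integral>\<^sup>+ t. ennreal (normal_density t 1 x) \<partial>\<nu>)"

text \<open>
  The posterior expectation of \<open>(\<theta> - a)\<^sup>2\<close> for a single coordinate observed at \<open>x\<close>, by Bayes' formula.
\<close>

definition post_risk :: "real measure \<Rightarrow> real \<Rightarrow> real \<Rightarrow> ennreal" where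
  "post_risk \<nu> a x =
     (\<integral>\<^sup>+ t. ennreal ((t - a)\<^sup>2) * ennreal (normal_density t 1 x) \<partial>\<nu>) / evidence \<nu> x"

lemma sets_normal_law [simp, measurable_cong]: "sets (normal_law m v) = sets borel"
  by (simp add: normal_law_def)

lemma space_normal_law [simp]: "space (normal_law m v) = UNIV"
  by (simp add: normal_law_def)

text \<open>
  The law is a probability even for negative \<open>v\<close>: the real square root is odd and only its square
  enters the normal density, so \<open>\<bar>v\<bar>\<close> acts as the variance. This makes \<open>normal_law m\<close> a
  Markov kernel on the whole line.
\<close>

lemma prob_space_normal_law: "prob_space (normal_law m v)"
proof (cases "v = 0")
  case True
  then show ?thesis by (simp add: normal_law_def prob_space_return)
next
  case False
  have sqrt_sq: "(sqrt v)\<^sup>2 = \<bar>v\<bar>"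
    by (cases "v \<ge> 0") (simp_all add: real_sqrt_minus[symmetric] power2_eq_square)
  have "normal_density m (sqrt v) = normal_density m (sqrt \<bar>v\<bar>)"
    by (simp add: normal_density_def fun_eq_iff sqrt_sq)
  with False show ?thesis
    by (simp add: normal_law_def prob_space_normal_density)
qed

lemma measurable_normal_law [measurable]: "normal_law m \<in> borel \<rightarrow>\<^sub>M subprob_algebra borel"
proof (rule measurable_subprob_algebra)
  fix v show "subprob_space (normal_law m v)"
    by (intro prob_space_imp_subprob_space prob_space_normal_law)
  show "sets (normal_law m v) = sets borel" by simp
next
  fix A :: "real set" assume [measurable]: "A \<in> sets borel"
  have "emeasure (normal_law m v) A =
      (if v = 0 then indicator A m
       else \<integral>\<^sup>+ t. ennreal (normal_density m (sqrt v) t) * indicator A t \<partial>lborel)" for v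
    by (auto simp: normal_law_def emeasure_density)
  then show "(\<lambda>v. emeasure (normal_law m v) A) \<in> borel_measurable borel"
    unfolding normal_density_def by simp
qed

lemma normal_density_le_1: "normal_density t 1 x \<le> 1"
proof -
  have "1 \<le> sqrt (2 * pi)" using pi_gt3 by (simp add: real_le_rsqrt)
  moreover have "exp (- (x - t)\<^sup>2 / 2) \<le> 1" by simp
  ultimately have "exp (- (x - t)\<^sup>2 / 2) \<le> sqrt (2 * pi)" by linarith
  then show ?thesis by (simp add: normal_density_def divide_simps)
qed

lemma normal_density_measurable2 [measurable (raw)]:
  assumes [measurable]: "f \<in> borel_measurable M" "g \<in> borel_measurable M" "h \<in> borel_measurable M"
  shows "(\<lambda>x. normal_density (f x) (g x) (h x)) \<in> borel_measurable M"
  unfolding normal_density_def by measurable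

text \<open>
  The normalisation of the prior cancels in Bayes' formula, which makes sense for every positive and
  finite mass. For the inverse-Gaussian density, crude bounds can thus replace the exact integral.
\<close>

locale mixing_density =
  fixes d :: "real \<Rightarrow> real"
  assumes meas [measurable]: "d \<in> borel_measurable borel"
    and mass_finite: "(\<integral>\<^sup>+ u. ennreal (d u) \<partial>lborel) < \<infinity>"
    and mass_pos: "(\<integral>\<^sup>+ u. ennreal (d u) \<partial>lborel) > 0"
begin

abbreviation \<nu> :: "real measure" where "\<nu> \<equiv> scale_mixture d"

lemma kernel [measurable]: "normal_law 0 \<in> density lborel d \<rightarrow>\<^sub>M subprob_algebra borel"
  by simp

lemma sets_mixture [simp, measurable_cong]: "sets \<nu> = sets borel"
  unfolding scale_mixture_def by (rule sets_bind_measurable[OF kernel]) simp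

lemma space_mixture [simp]: "space \<nu> = UNIV"
  using sets_eq_imp_space_eq[OF sets_mixture] by simp

lemma nn_integral_mixture:
  assumes [measurable]: "f \<in> borel_measurable borel"
  shows "(\<integral>\<^sup>+ t. f t \<partial>\<nu>) = (\<integral>\<^sup>+ u. ennreal (d u) * (\<integral>\<^sup>+ t. f t \<partial>normal_law 0 u) \<partial>lborel)"
  unfolding scale_mixture_def
  by (subst nn_integral_bind[OF _ kernel])
     (auto intro!: nn_integral_density simp: nn_integral_measurable_subprob_algebra2)

lemma emeasure_mixture: "emeasure \<nu> UNIV = (\<integral>\<^sup>+ u. ennreal (d u) \<partial>lborel)"
proof -
  have "emeasure \<nu> UNIV = (\<integral>\<^sup>+ t. 1 \<partial>\<nu>)" by simp
  also have "\<dots> = (\<integral>\<^sup>+ u. ennreal (d u) \<partial>lborel)"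
    using prob_space.emeasure_space_1[OF prob_space_normal_law[of 0]]
    by (subst nn_integral_mixture) simp_all
  finally show ?thesis .
qed

sublocale mix: finite_measure \<nu>
  by standard (use mass_finite in \<open>simp add: emeasure_mixture\<close>)

sublocale mixs: product_sigma_finite "\<lambda>_ :: nat. \<nu>"
  by standard

lemma evidence_pos: "evidence \<nu> x \<noteq> 0"
proof
  assume "evidence \<nu> x = 0"
  then have "AE t in \<nu>. ennreal (normal_density t 1 x) = 0"
    unfolding evidence_def by (subst (asm) nn_integral_0_iff_AE) auto
  then have "AE t in \<nu>. False"
    by eventually_elim (use normal_density_pos[of 1 _ x] in \<open>auto simp: ennreal_eq_0_iff not_le[symmetric]\<close>)
  then have "emeasure \<nu> (space \<nu>) = 0" by (simp add: AE_iff_measurable[of UNIV])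
  then show False using mass_pos by (simp add: emeasure_mixture)
qed

lemma evidence_finite: "evidence \<nu> x \<noteq> \<infinity>"
proof -
  have "evidence \<nu> x \<le> (\<integral>\<^sup>+ t. 1 \<partial>\<nu>)"
    unfolding evidence_def by (intro nn_integral_mono) (simp add: normal_density_le_1)
  also have "\<dots> < \<infinity>" using mass_finite by (simp add: emeasure_mixture)
  finally show ?thesis by simp
qed

lemma evidence_measurable [measurable]: "evidence \<nu> \<in> borel_measurable borel"
  unfolding evidence_def[abs_def] by measurable

lemma post_risk_measurable [measurable]: "post_risk \<nu> a \<in> borel_measurable borel"
  unfolding post_risk_def[abs_def] by measurable

lemma ennreal_likelihood: "ennreal (likelihood n t X) = (\<Prod>i<n. ennreal (normal_density (t i) 1 (X i)))"
  by (simp add: likelihood_def prod_ennreal)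

lemma likelihood_measurable [measurable]:
  "(\<lambda>t. likelihood n t X) \<in> borel_measurable (prior n d)"
  unfolding likelihood_def prior_def by measurable

lemma sets_posterior [simp, measurable_cong]: "sets (posterior n d X) = sets (prior n d)"
  by (simp add: posterior_def)

lemma space_posterior [simp]: "space (posterior n d X) = space (prior n d)"
  by (simp add: posterior_def)

lemma total_evidence:
  "(\<integral>\<^sup>+ t. ennreal (likelihood n t X) \<partial>prior n d) = (\<Prod>i<n. evidence \<nu> (X i))"
  unfolding ennreal_likelihood prior_def evidence_def
  by (rule mixs.product_nn_integral_prod) auto

lemma component_prior: "i < n \<Longrightarrow> (\<lambda>t. t i) \<in> prior n d \<rightarrow>\<^sub>M borel"
  unfolding prior_def by (rule measurable_compose[OF measurable_component_singleton[of i]]) auto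

text \<open>
  Prior and likelihood are both products over the coordinates, so all factors other than the
  \<open>i\<close>-th cancel in Bayes' formula. Cancellation requires evidences different from 0 and \<open>\<infinity>\<close>.
\<close>

lemma nn_integral_posterior_component:
  assumes i: "i < n" and [measurable]: "f \<in> borel_measurable borel"
  shows "(\<integral>\<^sup>+ t. f (t i) \<partial>posterior n d X)
    = (\<integral>\<^sup>+ t. f t * ennreal (normal_density t 1 (X i)) \<partial>\<nu>) / evidence \<nu> (X i)"
proof -
  define Z where "Z = (\<Prod>j<n. evidence \<nu> (X j))"
  define R where "R = (\<Prod>j\<in>{..<n} - {i}. evidence \<nu> (X j))"
  define A where "A = (\<integral>\<^sup>+ t. f t * ennreal (normal_density t 1 (X i)) \<partial>\<nu>)"
  define g where "g j t = (if j = i then f t else 1) * ennreal (normal_density t 1 (X j))" for j t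
  have g_meas: "g j \<in> borel_measurable \<nu>" for j
    by (cases "j = i") (simp_all add: g_def[abs_def])
  have gi: "integral\<^sup>N \<nu> (g i) = A"
    by (simp add: g_def[abs_def] A_def)
  have gj: "integral\<^sup>N \<nu> (g j) = evidence \<nu> (X j)" if "j \<noteq> i" for j
    using that by (simp add: g_def[abs_def] evidence_def)
  note [measurable] = component_prior[OF i]
  have Z: "Z = evidence \<nu> (X i) * R"
    unfolding Z_def R_def using i by (intro prod.remove) auto
  have R: "R \<noteq> 0" "R \<noteq> \<infinity>"
    using evidence_pos evidence_finite
    by (auto simp: R_def ennreal_prod_eq_top)
  have "(\<integral>\<^sup>+ t. f (t i) \<partial>posterior n d X)
      = (\<integral>\<^sup>+ t. (ennreal (likelihood n t X) / Z) * f (t i) \<partial>prior n d)"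
    unfolding posterior_def total_evidence Z_def by (rule nn_integral_density) auto
  also have "\<dots> = (\<integral>\<^sup>+ t. (f (t i) * ennreal (likelihood n t X)) / Z \<partial>prior n d)"
    by (simp add: divide_ennreal_def ac_simps)
  also have "\<dots> = (\<integral>\<^sup>+ t. f (t i) * ennreal (likelihood n t X) \<partial>prior n d) / Z"
    by (rule nn_integral_divide) auto
  also have "(\<lambda>t. f (t i) * ennreal (likelihood n t X)) = (\<lambda>t. \<Prod>j<n. g j (t j))"
  proof
    fix t
    have "(\<Prod>j<n. if j = i then f (t j) else 1) = f (t i)"
      using i by (simp add: prod.delta)
    then show "f (t i) * ennreal (likelihood n t X) = (\<Prod>j<n. g j (t j))"
      by (simp add: g_def prod.distrib ennreal_likelihood)
  qed
  also have "(\<integral>\<^sup>+ t. (\<Prod>j<n. g j (t j)) \<partial>prior n d) = (\<Prod>j<n. \<integral>\<^sup>+ t. g j t \<partial>\<nu>)"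
    unfolding prior_def by (rule mixs.product_nn_integral_prod) (auto simp: g_meas)
  also have "\<dots> = A * R"
    using i by (subst prod.remove[of _ i]) (auto simp: gi gj R_def)
  also have "A * R / Z = A / evidence \<nu> (X i)"
    unfolding Z by (rule divide_mult_eq) (use R in auto)
  finally show ?thesis unfolding A_def .
qed

lemma prob_space_posterior: "prob_space (posterior n d X)"
proof
  define Z where "Z = (\<Prod>j<n. evidence \<nu> (X j))"
  have Z: "Z \<noteq> 0" "Z \<noteq> \<infinity>"
    using evidence_pos evidence_finite by (auto simp: Z_def ennreal_prod_eq_top)
  have "emeasure (posterior n d X) (space (posterior n d X))
      = (\<integral>\<^sup>+ t. ennreal (likelihood n t X) / Z \<partial>prior n d)"
    unfolding space_posterior unfolding posterior_def total_evidence Z_def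
    by (subst emeasure_density) (auto intro!: nn_integral_cong)
  also have "\<dots> = Z / Z"
    by (subst nn_integral_divide) (auto simp: total_evidence Z_def)
  also have "\<dots> = 1" using Z by (simp add: top.not_eq_extremum)
  finally show "emeasure (posterior n d X) (space (posterior n d X)) = 1" .
qed

lemma sq_dist_eq: "sq_dist n s t = (\<Sum>i<n. (s i - t i)\<^sup>2)"
  by (simp add: sq_dist_def L2_set_def sum_nonneg)

lemma nn_integral_posterior_sq_dist:
  "(\<integral>\<^sup>+ t. ennreal (sq_dist n t s) \<partial>posterior n d X) = (\<Sum>i<n. post_risk \<nu> (s i) (X i))"
proof -
  have "(\<integral>\<^sup>+ t. ennreal (sq_dist n t s) \<partial>posterior n d X)
      = (\<Sum>i<n. \<integral>\<^sup>+ t. ennreal ((t i - s i)\<^sup>2) \<partial>posterior n d X)"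
    by (subst nn_integral_sum[symmetric])
       (auto simp: sq_dist_eq component_prior cong: measurable_cong_sets
             intro!: measurable_compose[OF _ measurable_ennreal] borel_measurable_power borel_measurable_diff)
  also have "\<dots> = (\<Sum>i<n. post_risk \<nu> (s i) (X i))"
    unfolding post_risk_def
    by (intro sum.cong refl nn_integral_posterior_component[where f="\<lambda>t. ennreal ((t - s _)\<^sup>2)"]) auto
  finally show ?thesis .
qed

end

text \<open>
  Jensen's inequality, in a form that allows \<open>f\<close> to be non-integrable (the right-hand side is then
  \<open>\<infinity>\<close>).
\<close>

lemma (in prob_space) square_mean_diff_le:
  fixes f :: "'a \<Rightarrow> real"
  assumes [measurable]: "f \<in> borel_measurable M"
  shows "ennreal (((\<integral>x. f x \<partial>M) - a)\<^sup>2) \<le> (\<integral>\<^sup>+ x. ennreal ((f x - a)\<^sup>2) \<partial>M)"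
proof (cases "(\<integral>\<^sup>+ x. ennreal ((f x - a)\<^sup>2) \<partial>M) = \<infinity>")
  case False
  then have int: "integrable M (\<lambda>x. (f x - a)\<^sup>2)"
    by (intro integrableI_nonneg) (auto simp: top.not_eq_extremum)
  then have i1: "integrable M (\<lambda>x. f x - a)"
    by (rule square_integrable_imp_integrable[rotated]) measurable
  then have "integrable M (\<lambda>x. (f x - a) + a)" by (intro Bochner_Integration.integrable_add) auto
  then have i2: "integrable M f" by simp
  have "(expectation f - a)\<^sup>2 = (expectation (\<lambda>x. f x - a))\<^sup>2"
    using i2 by (simp add: prob_space)
  also have "\<dots> \<le> expectation (\<lambda>x. (f x - a)\<^sup>2)"
    using variance_eq[OF i1 int] variance_positive[of "\<lambda>x. f x - a"] by linarith
  finally show ?thesis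
    using int by (subst nn_integral_eq_integral) (auto intro: ennreal_leI)
qed simp

context mixing_density begin

lemma posterior_mean_sq_dist_le:
  "ennreal (sq_dist n (posterior_mean n d X) s) \<le> (\<Sum>i<n. post_risk \<nu> (s i) (X i))"
proof -
  interpret P: prob_space "posterior n d X" by (rule prob_space_posterior)
  have "ennreal (sq_dist n (posterior_mean n d X) s)
      = (\<Sum>i<n. ennreal ((posterior_mean n d X i - s i)\<^sup>2))"
    by (simp add: sq_dist_eq sum_ennreal)
  also have "\<dots> \<le> (\<Sum>i<n. \<integral>\<^sup>+ t. ennreal ((t i - s i)\<^sup>2) \<partial>posterior n d X)"
    unfolding posterior_mean_def
    by (intro sum_mono P.square_mean_diff_le) (auto simp: component_prior cong: measurable_cong_sets)
  also have "\<dots> = (\<Sum>i<n. post_risk \<nu> (s i) (X i))"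
    unfolding post_risk_def
    by (intro sum.cong refl nn_integral_posterior_component[where f="\<lambda>t. ennreal ((t - s _)\<^sup>2)"]) auto
  finally show ?thesis .
qed

text \<open>
  Markov's inequality for the posterior.
\<close>

lemma posterior_tail_le:
  assumes "r > 0"
  shows "emeasure (posterior n d X) {t \<in> space (posterior n d X). sq_dist n t s > r}
    \<le> ennreal (1 / r) * (\<Sum>i<n. post_risk \<nu> (s i) (X i))"
proof -
  have m [measurable]: "(\<lambda>t. sq_dist n t s) \<in> borel_measurable (posterior n d X)"
    unfolding sq_dist_eq
    by (intro borel_measurable_sum borel_measurable_power borel_measurable_diff)
       (auto simp: component_prior cong: measurable_cong_sets)
  let ?S = "space (posterior n d X)"
  have "emeasure (posterior n d X) {t \<in> ?S. sq_dist n t s > r}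
      \<le> emeasure (posterior n d X) {t \<in> ?S. 1 \<le> ennreal (1 / r) * ennreal (sq_dist n t s)}"
  proof (rule emeasure_mono)
    have "1 \<le> ennreal (1 / r) * ennreal (sq_dist n t s)" if "sq_dist n t s > r" for t
      using that assms by (subst ennreal_mult[symmetric]) (auto simp: divide_simps)
    then show "{t \<in> ?S. sq_dist n t s > r} \<subseteq> {t \<in> ?S. 1 \<le> ennreal (1 / r) * ennreal (sq_dist n t s)}"
      by auto
    show "{t \<in> ?S. 1 \<le> ennreal (1 / r) * ennreal (sq_dist n t s)} \<in> sets (posterior n d X)"
      by measurable
  qed
  also have "\<dots> \<le> ennreal (1 / r) * (\<integral>\<^sup>+ t. ennreal (sq_dist n t s) * indicator ?S t \<partial>posterior n d X)"
    by (rule nn_integral_Markov_inequality) auto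
  also have "(\<integral>\<^sup>+ t. ennreal (sq_dist n t s) * indicator ?S t \<partial>posterior n d X)
      = (\<Sum>i<n. post_risk \<nu> (s i) (X i))"
    by (subst nn_integral_posterior_sq_dist[symmetric]) (auto intro!: nn_integral_cong)
  finally show ?thesis .
qed

lemma obs_law_component: "i < n \<Longrightarrow> (\<lambda>X. X i) \<in> obs_law n s \<rightarrow>\<^sub>M borel"
  using measurable_component_singleton[of i "{..<n}" "\<lambda>i. normal_law (s i) 1"]
  unfolding obs_law_def by (simp cong: measurable_cong_sets)

lemma nn_integral_obs_law_sum:
  "(\<integral>\<^sup>+ X. (\<Sum>i<n. post_risk \<nu> (s i) (X i)) \<partial>obs_law n s)
     = (\<Sum>i<n. \<integral>\<^sup>+ x. post_risk \<nu> (s i) x \<partial>normal_law (s i) 1)"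
proof -
  interpret product_prob_space "\<lambda>i. normal_law (s i) 1" "{..<n}"
    by (intro product_prob_spaceI prob_space_normal_law)
  have dis: "distr (obs_law n s) borel (\<lambda>X. X i) = normal_law (s i) 1" if "i < n" for i
  proof -
    have "distr (obs_law n s) borel (\<lambda>X. X i) = distr (obs_law n s) (normal_law (s i) 1) (\<lambda>X. X i)"
      by (intro distr_cong) auto
    also have "\<dots> = normal_law (s i) 1"
      unfolding obs_law_def using that by (intro PiM_component) auto
    finally show ?thesis .
  qed
  have "(\<integral>\<^sup>+ X. (\<Sum>i<n. post_risk \<nu> (s i) (X i)) \<partial>obs_law n s)
      = (\<Sum>i<n. \<integral>\<^sup>+ X. post_risk \<nu> (s i) (X i) \<partial>obs_law n s)"
    by (intro nn_integral_sum measurable_compose[OF obs_law_component]) auto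
  also have "\<dots> = (\<Sum>i<n. \<integral>\<^sup>+ x. post_risk \<nu> (s i) x \<partial>normal_law (s i) 1)"
  proof (intro sum.cong refl)
    fix i assume "i \<in> {..<n}"
    then have i: "i < n" by simp
    show "(\<integral>\<^sup>+ X. post_risk \<nu> (s i) (X i) \<partial>obs_law n s) = (\<integral>\<^sup>+ x. post_risk \<nu> (s i) x \<partial>normal_law (s i) 1)"
      unfolding dis[OF i, symmetric] using obs_law_component[OF i] by (subst nn_integral_distr) auto
  qed
  finally show ?thesis .
qed

lemma expected_posterior_tail_le:
  assumes "r > 0"
  shows "(\<integral>\<^sup>+ X. emeasure (posterior n d X) {t \<in> space (posterior n d X). sq_dist n t s > r} \<partial>obs_law n s)
    \<le> ennreal (1 / r) * (\<Sum>i<n. \<integral>\<^sup>+ x. post_risk \<nu> (s i) x \<partial>normal_law (s i) 1)"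
proof -
  have [measurable]: "(\<lambda>X. \<Sum>i<n. post_risk \<nu> (s i) (X i)) \<in> borel_measurable (obs_law n s)"
    by (intro borel_measurable_sum measurable_compose[OF obs_law_component]) auto
  have "(\<integral>\<^sup>+ X. emeasure (posterior n d X) {t \<in> space (posterior n d X). sq_dist n t s > r} \<partial>obs_law n s)
      \<le> (\<integral>\<^sup>+ X. ennreal (1 / r) * (\<Sum>i<n. post_risk \<nu> (s i) (X i)) \<partial>obs_law n s)"
    by (intro nn_integral_mono posterior_tail_le assms)
  also have "\<dots> = ennreal (1 / r) * (\<integral>\<^sup>+ X. (\<Sum>i<n. post_risk \<nu> (s i) (X i)) \<partial>obs_law n s)"
    by (rule nn_integral_cmult) measurable
  finally show ?thesis unfolding nn_integral_obs_law_sum .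
qed

lemma expected_posterior_mean_loss_le:
  "(\<integral>\<^sup>+ X. ennreal (sq_dist n (posterior_mean n d X) s) \<partial>obs_law n s)
    \<le> (\<Sum>i<n. \<integral>\<^sup>+ x. post_risk \<nu> (s i) x \<partial>normal_law (s i) 1)"
  unfolding nn_integral_obs_law_sum[symmetric]
  by (intro nn_integral_mono posterior_mean_sq_dist_le)

end

section \<open>Two integrals on the half-line\<close>

text \<open>
  Integration by parts on the half-line without any integrability hypothesis: on compact intervals
  \<open>\<integral>P = \<integral>Q + F - F\<close>, where the lower boundary term can be dropped because \<open>F \<ge> 0\<close>;
  monotone convergence does the rest. It is used for the score identity of the variance posterior
  and, with \<open>Q = 0\<close>, for integrals with a known antiderivative.
\<close>

lemma nn_integral_le_by_parts:
  fixes F P Q :: "real \<Rightarrow> real"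
  assumes F: "\<And>u. 0 < u \<Longrightarrow> (F has_real_derivative P u - Q u) (at u)"
    and nonneg: "\<And>u. 0 < u \<Longrightarrow> 0 \<le> F u" "\<And>u. 0 < u \<Longrightarrow> 0 \<le> P u" "\<And>u. 0 < u \<Longrightarrow> 0 \<le> Q u"
    and cont: "\<And>u. 0 < u \<Longrightarrow> isCont P u" "\<And>u. 0 < u \<Longrightarrow> isCont Q u"
    and [measurable]: "P \<in> borel_measurable borel" "Q \<in> borel_measurable borel"
    and lim: "(F \<longlongrightarrow> T) at_top"
  shows "(\<integral>\<^sup>+ u. ennreal (P u) * indicator {0<..} u \<partial>lborel)
    \<le> (\<integral>\<^sup>+ u. ennreal (Q u) * indicator {0<..} u \<partial>lborel) + ennreal T"
proof -
  define I where "I n = {1 / real (Suc n) .. real (Suc n)}" for n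
  have I_pos: "0 < u" if "u \<in> I n" for u n
    using that less_le_trans[of 0 "1 / real (Suc n)" u] by (auto simp: I_def)
  have mono_I: "I m \<subseteq> I n" if "m \<le> n" for m n
  proof -
    have "1 / real (Suc n) \<le> 1 / real (Suc m)" "real (Suc m) \<le> real (Suc n)"
      using that by (simp_all add: frac_le)
    then show ?thesis by (simp only: I_def atLeastatMost_subset_iff) blast
  qed
  have step: "(\<integral>\<^sup>+ u. ennreal (P u) * indicator (I n) u \<partial>lborel)
      \<le> (\<integral>\<^sup>+ u. ennreal (Q u) * indicator {0<..} u \<partial>lborel) + ennreal (F (real (Suc n)))" for n
  proof -
    have P: "integrable lborel (\<lambda>u. P u * indicator (I n) u)"
      and Q: "integrable lborel (\<lambda>u. Q u * indicator (I n) u)"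
      using I_pos[of _ n] cont unfolding I_def by (auto intro!: borel_integrable_atLeastAtMost)
    have le: "1 / real (Suc n) \<le> real (Suc n)" by (simp add: field_simps)
    have "integral\<^sup>L lborel (\<lambda>u. (P u - Q u) * indicator (I n) u) = F (real (Suc n)) - F (1 / real (Suc n))"
      unfolding I_def
    proof (rule has_bochner_integral_integral_eq[OF has_bochner_integral_FTC_Icc_real[OF le]])
      fix u assume "1 / real (Suc n) \<le> u" "u \<le> real (Suc n)"
      then have "0 < u" using I_pos[of u n] by (simp add: I_def)
      then show "(F has_real_derivative P u - Q u) (at u)" "isCont (\<lambda>u. P u - Q u) u"
        using F cont by (auto intro: continuous_diff)
    qed
    also have "integral\<^sup>L lborel (\<lambda>u. (P u - Q u) * indicator (I n) u)
        = integral\<^sup>L lborel (\<lambda>u. P u * indicator (I n) u) - integral\<^sup>L lborel (\<lambda>u. Q u * indicator (I n) u)"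
      using P Q by (simp add: left_diff_distrib)
    finally have eq: "integral\<^sup>L lborel (\<lambda>u. P u * indicator (I n) u)
        \<le> integral\<^sup>L lborel (\<lambda>u. Q u * indicator (I n) u) + F (real (Suc n))"
      using nonneg(1)[of "1 / real (Suc n)"] by simp
    have pos: "0 \<le> P u * indicator (I n) u" "0 \<le> Q u * indicator (I n) u" for u
      using nonneg I_pos[of u n] by (auto split: split_indicator)
    have "(\<integral>\<^sup>+ u. ennreal (P u) * indicator (I n) u \<partial>lborel)
        = (\<integral>\<^sup>+ u. ennreal (P u * indicator (I n) u) \<partial>lborel)"
      by (intro nn_integral_cong) (auto split: split_indicator)
    also have "\<dots> = ennreal (integral\<^sup>L lborel (\<lambda>u. P u * indicator (I n) u))"
      using P pos by (intro nn_integral_eq_integral) auto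
    also have "\<dots> \<le> ennreal (integral\<^sup>L lborel (\<lambda>u. Q u * indicator (I n) u) + F (real (Suc n)))"
      by (intro ennreal_leI eq)
    also have "\<dots> = ennreal (integral\<^sup>L lborel (\<lambda>u. Q u * indicator (I n) u)) + ennreal (F (real (Suc n)))"
      using pos nonneg(1)[of "real (Suc n)"] by (intro ennreal_plus integral_nonneg_AE) auto
    also have "ennreal (integral\<^sup>L lborel (\<lambda>u. Q u * indicator (I n) u))
        = (\<integral>\<^sup>+ u. ennreal (Q u * indicator (I n) u) \<partial>lborel)"
      using Q pos by (intro nn_integral_eq_integral[symmetric]) auto
    also have "\<dots> \<le> (\<integral>\<^sup>+ u. ennreal (Q u) * indicator {0<..} u \<partial>lborel)"
      by (intro nn_integral_mono) (auto split: split_indicator dest: I_pos)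
    finally show ?thesis by (simp add: add_right_mono)
  qed
  have meas_I [measurable]: "I n \<in> sets borel" for n by (simp add: I_def)
  have "(\<lambda>n. \<integral>\<^sup>+ u. ennreal (P u) * indicator (I n) u \<partial>lborel)
      \<longlonglongrightarrow> (\<integral>\<^sup>+ u. ennreal (P u) * indicator {0<..} u \<partial>lborel)"
  proof (rule nn_integral_LIMSEQ)
    show "incseq (\<lambda>n u. ennreal (P u) * indicator (I n) u)"
      using mono_I by (auto simp: incseq_def le_fun_def split: split_indicator)
    show "(\<lambda>u. ennreal (P u) * indicator (I n) u) \<in> borel_measurable lborel" for n
      by measurable
    fix u :: real
    show "(\<lambda>n. ennreal (P u) * indicator (I n) u) \<longlonglongrightarrow> ennreal (P u) * indicator {0<..} u"
    proof (cases "0 < u")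
      case True
      obtain m :: nat where m: "u \<le> real m" "1 / u \<le> real m"
        using real_arch_simple[of "max u (1 / u)"] by auto
      have "u \<in> I n" if "n \<ge> m" for n
      proof -
        have "1 / u \<le> real (Suc n)" "u \<le> real (Suc n)" using m that by simp_all
        then show ?thesis using True by (auto simp: I_def field_simps)
      qed
      then have "eventually (\<lambda>n. ennreal (P u) * indicator (I n) u = ennreal (P u)) sequentially"
        unfolding eventually_sequentially by (auto intro!: exI[of _ m])
      then show ?thesis using True by (auto intro: tendsto_eventually)
    next
      case False
      then have "u \<notin> I n" for n using I_pos by blast
      with False show ?thesis by simp
    qed
  qed
  moreover have "(\<lambda>n. (\<integral>\<^sup>+ u. ennreal (Q u) * indicator {0<..} u \<partial>lborel) + ennreal (F (real (Suc n))))
      \<longlonglongrightarrow> (\<integral>\<^sup>+ u. ennreal (Q u) * indicator {0<..} u \<partial>lborel) + ennreal T"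
    by (intro tendsto_add tendsto_const tendsto_ennrealI filterlim_compose[OF lim]
        filterlim_compose[OF filterlim_real_sequentially filterlim_Suc])
  ultimately show ?thesis
    by (rule LIMSEQ_le) (use step in blast)
qed

lemma arctan_sqrt_deriv:
  assumes "c > 0" "u > 0"
  shows "((\<lambda>u. 2 * arctan (sqrt u / c)) has_real_derivative c / (sqrt u * (c\<^sup>2 + u))) (at u)"
proof -
  have e: "1 + (sqrt u / c)\<^sup>2 = (c\<^sup>2 + u) / c\<^sup>2"
    using assms by (simp add: power_divide field_simps)
  have "((\<lambda>u. sqrt u / c) has_real_derivative (inverse (sqrt u) / 2) / c) (at u)"
    using assms by (intro DERIV_cdivide DERIV_real_sqrt)
  from DERIV_cmult[OF DERIV_chain2[OF DERIV_arctan this], of 2]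
  have "((\<lambda>u. 2 * arctan (sqrt u / c)) has_real_derivative
      2 * (inverse (1 + (sqrt u / c)\<^sup>2) * (inverse (sqrt u) / 2 / c))) (at u)" .
  also have "2 * (inverse (1 + (sqrt u / c)\<^sup>2) * (inverse (sqrt u) / 2 / c)) = c / (sqrt u * (c\<^sup>2 + u))"
  proof -
    have "2 * (inverse (A / c\<^sup>2) * (inverse s / 2 / c)) = c / (s * A)" if "A \<noteq> 0" "s \<noteq> 0" for A s
      using assms that by (simp add: field_simps power2_eq_square)
    moreover have "c\<^sup>2 + u \<noteq> 0" "sqrt u \<noteq> 0"
      using assms by (auto simp: add_nonneg_eq_0_iff)
    ultimately show ?thesis unfolding e by blast
  qed
  finally show ?thesis .
qed

text \<open>
  The only explicit integral needed: both the mass and the mean of the inverse-Gaussian mixing density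
  are dominated by an integral of this shape, by estimating one of the two exponential factors with
  \<open>exp (- y) \<le> 1 / (1 + y)\<close>.
\<close>

lemma nn_integral_sqrt_rational:
  assumes c: "c > 0"
  shows "(\<integral>\<^sup>+ u. ennreal (c / (sqrt u * (c\<^sup>2 + u))) * indicator {0<..} u \<partial>lborel) \<le> ennreal pi"
proof -
  have "(\<integral>\<^sup>+ u. ennreal (c / (sqrt u * (c\<^sup>2 + u))) * indicator {0<..} u \<partial>lborel)
    \<le> (\<integral>\<^sup>+ u. ennreal 0 * indicator {0<..} (u::real) \<partial>lborel) + ennreal pi"
  proof (rule nn_integral_le_by_parts[where F="\<lambda>u. 2 * arctan (sqrt u / c)" and Q="\<lambda>_. 0"])
    fix u :: real assume u: "0 < u"
    show "((\<lambda>u. 2 * arctan (sqrt u / c)) has_real_derivative c / (sqrt u * (c\<^sup>2 + u)) - 0) (at u)"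
      using arctan_sqrt_deriv[OF c u] by simp
    have "c\<^sup>2 + u \<noteq> 0" using u c by (smt (verit) zero_le_power2)
    then show "isCont (\<lambda>u. c / (sqrt u * (c\<^sup>2 + u))) u"
      using u by (auto intro!: continuous_intros)
  next
    have "filterlim (\<lambda>u. sqrt u * (1 / c)) at_top at_top"
      using c by (intro filterlim_at_top_mult_tendsto_pos[OF tendsto_const] sqrt_at_top) auto
    then have "((\<lambda>u. 2 * arctan (sqrt u / c)) \<longlongrightarrow> 2 * (pi / 2)) at_top"
      by (intro tendsto_mult tendsto_const filterlim_compose[OF tendsto_arctan_at_top]) simp
    then show "((\<lambda>u. 2 * arctan (sqrt u / c)) \<longlongrightarrow> pi) at_top" by simp
  qed (use c in \<open>auto simp: intro!: divide_nonneg_nonneg mult_nonneg_nonneg add_nonneg_nonneg\<close>)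
  then show ?thesis by simp
qed

section \<open>The posterior of one coordinate given its variance\<close>

text \<open>
  Bayes' formula for the conjugate normal model: given the variance \<open>u\<close>, the observation has
  variance \<open>1 + u\<close> and the posterior of \<open>t\<close> is normal. The proof completes the square.
\<close>

lemma normal_density_prod:
  fixes u x t :: real
  assumes u: "u > 0"
  shows "normal_density 0 (sqrt u) t * normal_density t 1 x
    = normal_density 0 (sqrt (1 + u)) x * normal_density (x * u / (1 + u)) (sqrt (u / (1 + u))) t"
proof -
  have e: "- (t - 0)\<^sup>2 / (2 * (sqrt u)\<^sup>2) + - (x - t)\<^sup>2 / (2 * 1\<^sup>2)
      = - (x - 0)\<^sup>2 / (2 * (sqrt (1 + u))\<^sup>2)
        + - (t - x * u / (1 + u))\<^sup>2 / (2 * (sqrt (u / (1 + u)))\<^sup>2)"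
  proof -
    have "1 + u \<noteq> 0" "u \<noteq> 0" using u by auto
    moreover have "(t - x * u / (1 + u))\<^sup>2 = (t * (1 + u) - x * u)\<^sup>2 / (1 + u)\<^sup>2"
      using u by (simp add: field_simps power2_eq_square)
    ultimately show ?thesis
      using u by (simp add: divide_simps power2_eq_square) (simp add: algebra_simps)
  qed
  have c: "1 / sqrt (2 * pi * (sqrt u)\<^sup>2) * (1 / sqrt (2 * pi * 1\<^sup>2))
      = 1 / sqrt (2 * pi * (sqrt (1 + u))\<^sup>2) * (1 / sqrt (2 * pi * (sqrt (u / (1 + u)))\<^sup>2))"
    using u by (simp add: real_sqrt_mult[symmetric] field_simps)
  have "normal_density 0 (sqrt u) t * normal_density t 1 x
     = (1 / sqrt (2 * pi * (sqrt u)\<^sup>2) * (1 / sqrt (2 * pi * 1\<^sup>2)))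
       * exp (- (t - 0)\<^sup>2 / (2 * (sqrt u)\<^sup>2) + - (x - t)\<^sup>2 / (2 * 1\<^sup>2))"
    unfolding normal_density_def exp_add by simp
  also have "\<dots> = normal_density 0 (sqrt (1 + u)) x * normal_density (x * u / (1 + u)) (sqrt (u / (1 + u))) t"
    unfolding c e normal_density_def exp_add by simp
  finally show ?thesis .
qed

lemma nn_integral_normal_sq:
  assumes s: "s > 0"
  shows "(\<integral>\<^sup>+ t. ennreal ((t - a)\<^sup>2) * ennreal (normal_density m s t) \<partial>lborel) = ennreal (s\<^sup>2 + (m - a)\<^sup>2)"
proof -
  have h: "has_bochner_integral lborel
      (\<lambda>t. normal_density m s t * (t - m)\<^sup>2 + (2 * (m - a)) * (normal_density m s t * (t - m))
           + (m - a)\<^sup>2 * normal_density m s t) (s\<^sup>2 + 2 * (m - a) * 0 + (m - a)\<^sup>2 * 1)"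
    using normal_moment_even[OF s, of m 1] normal_moment_odd[OF s, of m 0] normal_moment_even[OF s, of m 0]
    by (intro has_bochner_integral_add has_bochner_integral_mult_right)
       (simp_all add: fact_numeral numeral_2_eq_2)
  have "(\<lambda>t. normal_density m s t * (t - m)\<^sup>2 + (2 * (m - a)) * (normal_density m s t * (t - m))
           + (m - a)\<^sup>2 * normal_density m s t) = (\<lambda>t. (t - a)\<^sup>2 * normal_density m s t)"
    by (simp add: fun_eq_iff power2_eq_square algebra_simps)
  with h have "has_bochner_integral lborel (\<lambda>t. (t - a)\<^sup>2 * normal_density m s t) (s\<^sup>2 + (m - a)\<^sup>2)"
    by simp
  then have "(\<integral>\<^sup>+ t. ennreal ((t - a)\<^sup>2 * normal_density m s t) \<partial>lborel) = ennreal (s\<^sup>2 + (m - a)\<^sup>2)"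
    by (subst nn_integral_eq_integral) (auto simp: has_bochner_integral_iff)
  then show ?thesis by (simp add: ennreal_mult)
qed

lemma nn_integral_normal_density_1:
  "s > 0 \<Longrightarrow> (\<integral>\<^sup>+ t. ennreal (normal_density m s t) \<partial>lborel) = 1"
  using prob_space.emeasure_space_1[OF prob_space_normal_density[of s m]]
  by (simp add: emeasure_density)

lemma nn_integral_normal_law_posterior:
  assumes u: "u > 0" and [measurable]: "f \<in> borel_measurable borel"
  shows "(\<integral>\<^sup>+ t. f t * ennreal (normal_density t 1 x) \<partial>normal_law 0 u)
    = ennreal (normal_density 0 (sqrt (1 + u)) x)
      * (\<integral>\<^sup>+ t. f t * ennreal (normal_density (x * u / (1 + u)) (sqrt (u / (1 + u))) t) \<partial>lborel)"
proof -
  have "(\<integral>\<^sup>+ t. f t * ennreal (normal_density t 1 x) \<partial>normal_law 0 u)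
      = (\<integral>\<^sup>+ t. ennreal (normal_density 0 (sqrt u) t) * (f t * ennreal (normal_density t 1 x)) \<partial>lborel)"
    using u by (simp add: normal_law_def nn_integral_density)
  also have "\<dots> = (\<integral>\<^sup>+ t. f t * ennreal (normal_density 0 (sqrt u) t * normal_density t 1 x) \<partial>lborel)"
    by (simp add: ennreal_mult ac_simps)
  also have "\<dots> = (\<integral>\<^sup>+ t. ennreal (normal_density 0 (sqrt (1 + u)) x)
      * (f t * ennreal (normal_density (x * u / (1 + u)) (sqrt (u / (1 + u))) t)) \<partial>lborel)"
    unfolding normal_density_prod[OF u] by (simp add: ennreal_mult ac_simps)
  also have "\<dots> = ennreal (normal_density 0 (sqrt (1 + u)) x)
      * (\<integral>\<^sup>+ t. f t * ennreal (normal_density (x * u / (1 + u)) (sqrt (u / (1 + u))) t) \<partial>lborel)"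
    by (rule nn_integral_cmult) simp
  finally show ?thesis .
qed

context mixing_density begin

text \<open>
  The joint density of the variance \<open>u\<close> and the observation \<open>x\<close>, with the parameter integrated
  out; as a function of \<open>u\<close> it is the unnormalised posterior density of the variance.
\<close>

definition joint :: "real \<Rightarrow> real \<Rightarrow> ennreal" where
  "joint x u = ennreal (d u) * ennreal (normal_density 0 (sqrt (1 + u)) x)"

lemma joint_measurable [measurable]: "joint x \<in> borel_measurable borel"
  unfolding joint_def[abs_def] by measurable

lemma evidence_joint:
  assumes "\<And>u. u \<le> 0 \<Longrightarrow> d u = 0"
  shows "evidence \<nu> x = (\<integral>\<^sup>+ u. joint x u \<partial>lborel)"
proof -
  have "ennreal (d u) * (\<integral>\<^sup>+ t. ennreal (normal_density t 1 x) \<partial>normal_law 0 u) = joint x u" for u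
  proof (cases "u > 0")
    case True
    then show ?thesis
      using nn_integral_normal_law_posterior[OF True, of "\<lambda>_. 1" x]
      by (simp add: joint_def nn_integral_normal_density_1)
  qed (use assms in \<open>simp add: joint_def\<close>)
  then show ?thesis unfolding evidence_def by (subst nn_integral_mixture) auto
qed

lemma second_moment_joint:
  assumes "\<And>u. u \<le> 0 \<Longrightarrow> d u = 0"
  shows "(\<integral>\<^sup>+ t. ennreal ((t - x)\<^sup>2) * ennreal (normal_density t 1 x) \<partial>\<nu>)
    = (\<integral>\<^sup>+ u. joint x u * ennreal (u / (1 + u) + x\<^sup>2 / (1 + u)\<^sup>2) \<partial>lborel)"
proof -
  have "ennreal (d u) * (\<integral>\<^sup>+ t. ennreal ((t - x)\<^sup>2) * ennreal (normal_density t 1 x) \<partial>normal_law 0 u)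
      = joint x u * ennreal (u / (1 + u) + x\<^sup>2 / (1 + u)\<^sup>2)" for u
  proof (cases "u > 0")
    case True
    then have "x * u / (1 + u) - x = - x / (1 + u)" by (simp add: field_simps)
    then have "(sqrt (u / (1 + u)))\<^sup>2 + (x * u / (1 + u) - x)\<^sup>2 = u / (1 + u) + x\<^sup>2 / (1 + u)\<^sup>2"
      using True by (simp add: power_divide)
    then show ?thesis
      using True nn_integral_normal_law_posterior[OF True, of "\<lambda>t. ennreal ((t - x)\<^sup>2)" x]
        nn_integral_normal_sq[of "sqrt (u / (1 + u))" x "x * u / (1 + u)"]
      by (simp add: joint_def mult.assoc)
  qed (use assms in \<open>simp add: joint_def\<close>)
  then show ?thesis by (subst nn_integral_mixture) auto
qed

lemma prior_second_moment:
  assumes "\<And>u. u \<le> 0 \<Longrightarrow> d u = 0"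
  shows "(\<integral>\<^sup>+ t. ennreal (t\<^sup>2) \<partial>\<nu>) = (\<integral>\<^sup>+ u. ennreal (d u) * ennreal u \<partial>lborel)"
proof -
  have "ennreal (d u) * (\<integral>\<^sup>+ t. ennreal (t\<^sup>2) \<partial>normal_law 0 u) = ennreal (d u) * ennreal u" for u
  proof (cases "u > 0")
    case True
    then show ?thesis
      using nn_integral_normal_sq[of "sqrt u" 0 0]
      by (simp add: normal_law_def nn_integral_density mult.commute)
  qed (use assms in simp)
  then show ?thesis by (subst nn_integral_mixture) auto
qed

text \<open>
  At \<open>\<theta>\<^sub>0 = 0\<close> the data density is dominated by the evidence. Replacing it by \<open>1 / c\<close> times the
  evidence cancels the denominator of the posterior, and Fubini's theorem leaves the prior second
  moment.
\<close>

lemma risk_at_zero_le: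
  assumes c: "c > 0" and Z: "\<And>x. ennreal (c * normal_density 0 1 x) \<le> evidence \<nu> x"
  shows "(\<integral>\<^sup>+ x. post_risk \<nu> 0 x \<partial>normal_law 0 1) \<le> ennreal (1 / c) * (\<integral>\<^sup>+ t. ennreal (t\<^sup>2) \<partial>\<nu>)"
proof -
  interpret pair_sigma_finite lborel \<nu> ..
  define A where "A x = (\<integral>\<^sup>+ t. ennreal (t\<^sup>2) * ennreal (normal_density t 1 x) \<partial>\<nu>)" for x
  have [measurable]: "A \<in> borel_measurable borel" unfolding A_def[abs_def] by measurable
  have bound: "ennreal (normal_density 0 1 x) * post_risk \<nu> 0 x \<le> ennreal (1 / c) * A x" for x
  proof -
    have "ennreal (normal_density 0 1 x) = ennreal (1 / c) * ennreal (c * normal_density 0 1 x)"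
      using c by (subst ennreal_mult[symmetric]) auto
    also have "\<dots> \<le> ennreal (1 / c) * evidence \<nu> x" by (intro mult_left_mono Z) simp
    finally have "ennreal (normal_density 0 1 x) * post_risk \<nu> 0 x
        \<le> ennreal (1 / c) * evidence \<nu> x * (A x / evidence \<nu> x)"
      unfolding post_risk_def A_def by (simp add: mult_right_mono)
    also have "\<dots> = ennreal (1 / c) * (A x * evidence \<nu> x / evidence \<nu> x)"
      by (simp add: ennreal_times_divide ac_simps)
    also have "\<dots> = ennreal (1 / c) * A x"
      using evidence_pos evidence_finite by (subst ennreal_mult_divide_eq) auto
    finally show ?thesis .
  qed
  have "(\<integral>\<^sup>+ x. post_risk \<nu> 0 x \<partial>normal_law 0 1)
      = (\<integral>\<^sup>+ x. ennreal (normal_density 0 1 x) * post_risk \<nu> 0 x \<partial>lborel)"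
    by (simp add: normal_law_def nn_integral_density)
  also have "\<dots> \<le> (\<integral>\<^sup>+ x. ennreal (1 / c) * A x \<partial>lborel)"
    by (intro nn_integral_mono bound)
  also have "\<dots> = ennreal (1 / c) * (\<integral>\<^sup>+ x. A x \<partial>lborel)"
    by (rule nn_integral_cmult) simp
  also have "(\<integral>\<^sup>+ x. A x \<partial>lborel)
      = (\<integral>\<^sup>+ t. (\<integral>\<^sup>+ x. ennreal (t\<^sup>2) * ennreal (normal_density t 1 x) \<partial>lborel) \<partial>\<nu>)"
    unfolding A_def by (rule Fubini'[symmetric]) measurable
  also have "\<dots> = (\<integral>\<^sup>+ t. ennreal (t\<^sup>2) \<partial>\<nu>)"
    by (simp add: nn_integral_cmult nn_integral_normal_density_1)
  finally show ?thesis .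
qed

text \<open>
  A bound on the posterior spread around the observation that holds for every \<open>x\<close> gives a bound on
  the risk that is uniform in \<open>a\<close>, since the observation itself has squared error 1 on average.
\<close>

lemma risk_le:
  assumes C: "C \<ge> 0"
    and num: "\<And>x. (\<integral>\<^sup>+ t. ennreal ((t - x)\<^sup>2) * ennreal (normal_density t 1 x) \<partial>\<nu>) \<le> ennreal C * evidence \<nu> x"
  shows "(\<integral>\<^sup>+ x. post_risk \<nu> a x \<partial>normal_law a 1) \<le> ennreal (2 * C + 2)"
proof -
  have bound: "post_risk \<nu> a x \<le> ennreal (2 * C) + 2 * ennreal ((x - a)\<^sup>2)" for x
  proof -
    have "(\<integral>\<^sup>+ t. ennreal ((t - a)\<^sup>2) * ennreal (normal_density t 1 x) \<partial>\<nu>)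
        \<le> (\<integral>\<^sup>+ t. 2 * (ennreal ((t - x)\<^sup>2) * ennreal (normal_density t 1 x))
              + (2 * ennreal ((x - a)\<^sup>2)) * ennreal (normal_density t 1 x) \<partial>\<nu>)"
    proof (rule nn_integral_mono)
      fix t
      have "(t - a)\<^sup>2 \<le> 2 * (t - x)\<^sup>2 + 2 * (x - a)\<^sup>2"
        using zero_le_power2[of "(t - x) - (x - a)"] by (simp add: power2_eq_square algebra_simps)
      then have "ennreal ((t - a)\<^sup>2) \<le> 2 * ennreal ((t - x)\<^sup>2) + 2 * ennreal ((x - a)\<^sup>2)"
        by (simp add: ennreal_plus[symmetric] ennreal_mult[symmetric] ennreal_numeral[symmetric]
            del: ennreal_plus ennreal_numeral)
      then show "ennreal ((t - a)\<^sup>2) * ennreal (normal_density t 1 x)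
          \<le> 2 * (ennreal ((t - x)\<^sup>2) * ennreal (normal_density t 1 x))
              + (2 * ennreal ((x - a)\<^sup>2)) * ennreal (normal_density t 1 x)"
        by (metis mult.assoc distrib_right mult_right_mono zero_le)
    qed
    also have "\<dots> = 2 * (\<integral>\<^sup>+ t. ennreal ((t - x)\<^sup>2) * ennreal (normal_density t 1 x) \<partial>\<nu>)
        + 2 * ennreal ((x - a)\<^sup>2) * evidence \<nu> x"
      unfolding evidence_def by (subst nn_integral_add) (auto simp: nn_integral_cmult)
    also have "\<dots> \<le> 2 * (ennreal C * evidence \<nu> x) + 2 * ennreal ((x - a)\<^sup>2) * evidence \<nu> x"
      by (intro add_right_mono mult_left_mono num) auto
    also have "\<dots> = (ennreal (2 * C) + 2 * ennreal ((x - a)\<^sup>2)) * evidence \<nu> x"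
      using C by (simp add: ennreal_mult distrib_right mult.assoc)
    finally show ?thesis
      unfolding post_risk_def
      using divide_right_mono_ennreal ennreal_mult_divide_eq[of "evidence \<nu> x"] evidence_pos evidence_finite
      by (metis infinity_ennreal_def)
  qed
  interpret N: prob_space "normal_law a 1" by (rule prob_space_normal_law)
  have "(\<integral>\<^sup>+ x. post_risk \<nu> a x \<partial>normal_law a 1)
      \<le> (\<integral>\<^sup>+ x. ennreal (2 * C) + 2 * ennreal ((x - a)\<^sup>2) \<partial>normal_law a 1)"
    by (intro nn_integral_mono bound)
  also have "\<dots> = ennreal (2 * C) + 2 * (\<integral>\<^sup>+ x. ennreal ((x - a)\<^sup>2) \<partial>normal_law a 1)"
    using N.emeasure_space_1 by (subst nn_integral_add) (auto simp: nn_integral_cmult)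
  also have "(\<integral>\<^sup>+ x. ennreal ((x - a)\<^sup>2) \<partial>normal_law a 1) = 1"
    using nn_integral_normal_sq[of 1 a a] by (simp add: normal_law_def nn_integral_density mult.commute)
  also have "ennreal (2 * C) + 2 * 1 = ennreal (2 * C + 2)"
    using C by (simp add: ennreal_plus[symmetric] ennreal_numeral[symmetric] del: ennreal_plus ennreal_numeral)
  finally show ?thesis .
qed

end

section \<open>The inverse-Gaussian mixing density\<close>

lemma ig_density_measurable [measurable]: "ig_density b \<tau> \<in> borel_measurable borel"
  unfolding ig_density_def[abs_def] by measurable

lemma powr_three_halves: "u > 0 \<Longrightarrow> u powr (3/2) = u * sqrt u" for u :: real
  using powr_add[of u 1 "1/2"] by (simp add: powr_half_sqrt)

lemma ig_density_eq:
  "u > 0 \<Longrightarrow> ig_density b \<tau> u = ig_const b \<tau> * \<tau> / (u * sqrt u) * exp (- (\<tau>\<^sup>2 / u) - b * u)"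
  by (simp add: ig_density_def powr_three_halves)

lemma exp_minus_le_inverse: "0 \<le> y \<Longrightarrow> exp (- y) \<le> 1 / (1 + y)" for y :: real
  using exp_ge_add_one_self[of y] by (simp add: exp_minus field_simps)

text \<open>
  The constant of the lower bound for the evidence at large observations, obtained from the
  variances in \<open>[2, 3]\<close>.
\<close>

definition tail_const :: "real \<Rightarrow> real" where
  "tail_const b = exp (- 1 - 3 * b) / (sqrt pi * (3 * sqrt 3) * (2 * sqrt (2 * pi)))"

locale inverse_gaussian =
  fixes b \<tau> :: real
  assumes b_pos: "0 < b" and \<tau>_pos: "0 < \<tau>" and \<tau>_le_1: "\<tau> \<le> 1"
begin

lemma ig_const_le: "ig_const b \<tau> \<le> exp (2 * sqrt b)"
proof -
  have s: "1 \<le> sqrt pi" using pi_gt3 by (simp add: real_le_rsqrt)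
  have "exp (2 * sqrt b * \<tau>) \<le> exp (2 * sqrt b) * sqrt pi"
  proof -
    have "exp (2 * sqrt b * \<tau>) \<le> exp (2 * sqrt b)"
      using b_pos \<tau>_le_1 by (simp add: mult_left_le)
    also have "\<dots> \<le> exp (2 * sqrt b) * sqrt pi" using s by simp
    finally show ?thesis .
  qed
  then show ?thesis by (simp add: ig_const_def field_simps)
qed

lemma ig_const_ge: "1 / sqrt pi \<le> ig_const b \<tau>"
  using b_pos \<tau>_pos by (simp add: ig_const_def divide_right_mono)

lemma ig_const_pos: "0 < ig_const b \<tau>"
  by (simp add: ig_const_def)

lemma ig_density_nonneg: "0 \<le> ig_density b \<tau> u"
  using ig_const_pos \<tau>_pos by (simp add: ig_density_def)

lemma ig_density_nonpos_arg: "u \<le> 0 \<Longrightarrow> ig_density b \<tau> u = 0"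
  by (simp add: ig_density_def)

lemma ig_density_le_kernel:
  assumes u: "0 < u"
  shows "ig_density b \<tau> u \<le> ig_const b \<tau> * (\<tau> / (sqrt u * (\<tau>\<^sup>2 + u)))"
proof -
  have "exp (- (\<tau>\<^sup>2 / u) - b * u) \<le> exp (- (\<tau>\<^sup>2 / u))" using b_pos u by simp
  also have "\<dots> \<le> 1 / (1 + \<tau>\<^sup>2 / u)" using u by (intro exp_minus_le_inverse) simp
  also have "\<dots> = u / (\<tau>\<^sup>2 + u)" using u by (simp add: field_simps)
  finally have "ig_density b \<tau> u \<le> ig_const b \<tau> * \<tau> / (u * sqrt u) * (u / (\<tau>\<^sup>2 + u))"
    unfolding ig_density_eq[OF u] using ig_const_pos \<tau>_pos u by (intro mult_left_mono) auto
  also have "\<dots> = ig_const b \<tau> * (\<tau> / (sqrt u * (\<tau>\<^sup>2 + u)))"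
    using u by simp
  finally show ?thesis .
qed

lemma ig_mass_le: "(\<integral>\<^sup>+ u. ennreal (ig_density b \<tau> u) \<partial>lborel) \<le> ennreal (exp (2 * sqrt b) * pi)"
proof -
  have "(\<integral>\<^sup>+ u. ennreal (ig_density b \<tau> u) \<partial>lborel)
      \<le> (\<integral>\<^sup>+ u. ennreal (exp (2 * sqrt b))
            * (ennreal (\<tau> / (sqrt u * (\<tau>\<^sup>2 + u))) * indicator {0<..} u) \<partial>lborel)"
  proof (rule nn_integral_mono)
    fix u :: real
    show "ennreal (ig_density b \<tau> u) \<le> ennreal (exp (2 * sqrt b))
            * (ennreal (\<tau> / (sqrt u * (\<tau>\<^sup>2 + u))) * indicator {0<..} u)"
    proof (cases "0 < u")
      case True
      have "ig_density b \<tau> u \<le> exp (2 * sqrt b) * (\<tau> / (sqrt u * (\<tau>\<^sup>2 + u)))"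
        using ig_density_le_kernel[OF True] ig_const_le \<tau>_pos True
        by (elim order_trans) (intro mult_right_mono, auto)
      then show ?thesis using True by (simp add: ennreal_mult'[symmetric] ennreal_leI)
    qed (simp add: ig_density_nonpos_arg)
  qed
  also have "\<dots> = ennreal (exp (2 * sqrt b))
      * (\<integral>\<^sup>+ u. ennreal (\<tau> / (sqrt u * (\<tau>\<^sup>2 + u))) * indicator {0<..} u \<partial>lborel)"
    by (rule nn_integral_cmult) simp
  also have "\<dots> \<le> ennreal (exp (2 * sqrt b)) * ennreal pi"
    by (intro mult_left_mono nn_integral_sqrt_rational \<tau>_pos) simp
  finally show ?thesis by (simp add: ennreal_mult)
qed

text \<open>
  The mean is of order \<open>\<tau>\<close>, although the mixing density concentrates at scale \<open>\<tau>\<^sup>2\<close>: its tail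
  \<open>\<tau> / u powr (3/2)\<close> is cut off only at the scale \<open>1 / b\<close> by the factor \<open>exp (- b u)\<close>.
\<close>

lemma ig_mean_le:
  "(\<integral>\<^sup>+ u. ennreal (ig_density b \<tau> u) * ennreal u \<partial>lborel)
    \<le> ennreal (exp (2 * sqrt b) * pi / sqrt b * \<tau>)"
proof -
  define c where "c = 1 / sqrt b"
  define B where "B = exp (2 * sqrt b) * \<tau> / sqrt b"
  have c: "c > 0" and B: "B \<ge> 0" using b_pos \<tau>_pos by (simp_all add: c_def B_def)
  have "(\<integral>\<^sup>+ u. ennreal (ig_density b \<tau> u) * ennreal u \<partial>lborel)
      \<le> (\<integral>\<^sup>+ u. ennreal B * (ennreal (c / (sqrt u * (c\<^sup>2 + u))) * indicator {0<..} u) \<partial>lborel)"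
  proof (rule nn_integral_mono)
    fix u :: real
    show "ennreal (ig_density b \<tau> u) * ennreal u
        \<le> ennreal B * (ennreal (c / (sqrt u * (c\<^sup>2 + u))) * indicator {0<..} u)"
    proof (cases "0 < u")
      case True
      have "exp (- (\<tau>\<^sup>2 / u) - b * u) \<le> exp (- (b * u))" using True by simp
      also have "\<dots> \<le> 1 / (1 + b * u)" using b_pos True by (intro exp_minus_le_inverse) simp
      finally have "ig_density b \<tau> u * u \<le> ig_const b \<tau> * \<tau> / (u * sqrt u) * (1 / (1 + b * u)) * u"
        unfolding ig_density_eq[OF True] using ig_const_pos \<tau>_pos True
        by (intro mult_right_mono mult_left_mono) auto
      also have "\<dots> = ig_const b \<tau> * (\<tau> / (sqrt u * (1 + b * u)))" using True by simp
      also have "\<dots> \<le> exp (2 * sqrt b) * (\<tau> / (sqrt u * (1 + b * u)))"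
        using b_pos \<tau>_pos True by (intro mult_right_mono ig_const_le) auto
      also have "\<dots> = B * (c / (sqrt u * (c\<^sup>2 + u)))"
      proof -
        have "c\<^sup>2 + u = (1 + b * u) / b"
          using b_pos by (simp add: c_def power_divide field_simps)
        moreover have "sqrt b * (sqrt b * y) = b * y" for y
          using b_pos by (simp add: mult.assoc[symmetric])
        moreover have "1 + b * u > 0" using b_pos True by (simp add: add_pos_pos)
        ultimately show ?thesis
          using b_pos True by (simp add: B_def c_def divide_simps mult.commute[of u b])
      qed
      finally show ?thesis
        using True B c ig_density_nonneg by (simp add: ennreal_mult[symmetric] ennreal_leI)
    qed (simp add: ig_density_nonpos_arg)
  qed
  also have "\<dots> = ennreal B
      * (\<integral>\<^sup>+ u. ennreal (c / (sqrt u * (c\<^sup>2 + u))) * indicator {0<..} u \<partial>lborel)"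
    by (rule nn_integral_cmult) simp
  also have "\<dots> \<le> ennreal B * ennreal pi"
    by (intro mult_left_mono nn_integral_sqrt_rational c) simp
  finally show ?thesis using B by (simp add: ennreal_mult[symmetric] B_def mult_ac)
qed

lemma ig_density_ge:
  assumes u: "0 < l" "l \<le> u" "u \<le> r"
  shows "\<tau> / (sqrt pi * (r * sqrt r)) * exp (- (\<tau>\<^sup>2 / l) - b * r) \<le> ig_density b \<tau> u"
proof -
  have pos: "0 < u" using u by simp
  have "\<tau> / (sqrt pi * (r * sqrt r)) = 1 / sqrt pi * \<tau> / (r * sqrt r)" by simp
  also have "\<dots> \<le> ig_const b \<tau> * \<tau> / (u * sqrt u)"
    using u \<tau>_pos ig_const_ge ig_const_pos by (intro frac_le mult_mono) auto
  finally have 1: "\<tau> / (sqrt pi * (r * sqrt r)) \<le> ig_const b \<tau> * \<tau> / (u * sqrt u)" .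
  have "\<tau>\<^sup>2 / u \<le> \<tau>\<^sup>2 / l" "b * u \<le> b * r"
    using u b_pos by (auto intro: divide_left_mono)
  then have 2: "exp (- (\<tau>\<^sup>2 / l) - b * r) \<le> exp (- (\<tau>\<^sup>2 / u) - b * u)" by simp
  show ?thesis unfolding ig_density_eq[OF pos]
    using 1 2 u \<tau>_pos ig_const_pos by (intro mult_mono) auto
qed

lemma ig_mass_pos: "0 < (\<integral>\<^sup>+ u. ennreal (ig_density b \<tau> u) \<partial>lborel)"
proof -
  define m where "m = \<tau> / (sqrt pi * (2 * sqrt 2)) * exp (- (\<tau>\<^sup>2 / 1) - b * 2)"
  have "0 < ennreal m * emeasure lborel {1..2::real}"
    using \<tau>_pos by (simp add: m_def)
  also have "\<dots> = (\<integral>\<^sup>+ u. ennreal m * indicator {1..2::real} u \<partial>lborel)"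
    by (rule nn_integral_cmult_indicator[symmetric]) simp
  also have "\<dots> \<le> (\<integral>\<^sup>+ u. ennreal (ig_density b \<tau> u) \<partial>lborel)"
    using ig_density_ge[of 1 _ 2] unfolding m_def
    by (intro nn_integral_mono) (auto split: split_indicator intro!: ennreal_leI)
  finally show ?thesis .
qed

sublocale mixing_density "ig_density b \<tau>"
proof
  show "ig_density b \<tau> \<in> borel_measurable borel" by measurable
  show "(\<integral>\<^sup>+ u. ennreal (ig_density b \<tau> u) \<partial>lborel) < \<infinity>"
    using ig_mass_le by (rule le_less_trans) simp
qed (rule ig_mass_pos)

section \<open>Bounds for the evidence and for small variances\<close>

lemma evidence_ig: "evidence \<nu> x = (\<integral>\<^sup>+ u. joint x u \<partial>lborel)"
  by (rule evidence_joint) (rule ig_density_nonpos_arg)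

lemma joint_real: "joint x u = ennreal (ig_density b \<tau> u * normal_density 0 (sqrt (1 + u)) x)"
  by (simp add: joint_def ig_density_nonneg ennreal_mult)

lemma marginal_ge:
  assumes u: "0 \<le> v" "v \<le> u" "u \<le> 3"
  shows "exp (- x\<^sup>2 / (2 * (1 + v))) / (2 * sqrt (2 * pi)) \<le> normal_density 0 (sqrt (1 + u)) x"
proof -
  have e: "exp (- x\<^sup>2 / (2 * (1 + v))) \<le> exp (- x\<^sup>2 / (2 * (1 + u)))"
    using u by (simp add: divide_left_mono)
  have "sqrt (1 + u) \<le> sqrt 4" using u by (intro real_sqrt_le_mono) simp
  then have "sqrt (2 * pi) * sqrt (1 + u) \<le> sqrt (2 * pi) * 2" by (intro mult_left_mono) auto
  then have s: "sqrt (2 * pi * (1 + u)) \<le> 2 * sqrt (2 * pi)"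
    unfolding real_sqrt_mult[of "2 * pi"] by linarith
  have "exp (- x\<^sup>2 / (2 * (1 + v))) / (2 * sqrt (2 * pi))
      \<le> exp (- x\<^sup>2 / (2 * (1 + u))) / sqrt (2 * pi * (1 + u))"
    using e s u by (intro frac_le) auto
  also have "\<dots> = normal_density 0 (sqrt (1 + u)) x"
    using u by (simp add: normal_density_def)
  finally show ?thesis .
qed

text \<open>
  Only the variances in \<open>[l, r]\<close> are kept. The bound \<open>r \<le> 3\<close> serves to estimate \<open>\<surd>(1 + u)\<close> by 2;
  \<open>v\<close> is decoupled from \<open>l\<close> so that \<open>v = 0\<close> can be chosen for tiny \<open>l\<close>.
\<close>

lemma evidence_ge:
  assumes l: "0 < l" "l \<le> r" "r \<le> 3" and v: "0 \<le> v" "v \<le> l"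
  shows "ennreal (\<tau> / (sqrt pi * (r * sqrt r)) * exp (- (\<tau>\<^sup>2 / l) - b * r)
      * (exp (- x\<^sup>2 / (2 * (1 + v))) / (2 * sqrt (2 * pi))) * (r - l)) \<le> evidence \<nu> x"
    (is "ennreal (?m * _) \<le> _")
proof -
  have m: "0 \<le> ?m" using \<tau>_pos l by (intro mult_nonneg_nonneg divide_nonneg_nonneg) auto
  have le: "?m \<le> ig_density b \<tau> u * normal_density 0 (sqrt (1 + u)) x" if "u \<in> {l..r}" for u
    using that l v ig_density_ge[of l u r] marginal_ge[of v u x] ig_density_nonneg \<tau>_pos
    by (intro mult_mono) auto
  have "ennreal (?m * (r - l)) = ennreal ?m * emeasure lborel {l..r}"
    using ennreal_mult[OF m, of "r - l"] l by simp
  also have "\<dots> = (\<integral>\<^sup>+ u. ennreal ?m * indicator {l..r} u \<partial>lborel)"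
    by (rule nn_integral_cmult_indicator[symmetric]) simp
  also have "\<dots> \<le> evidence \<nu> x"
    unfolding evidence_ig joint_real
  proof (rule nn_integral_mono)
    fix u
    show "ennreal ?m * indicator {l..r} u
        \<le> ennreal (ig_density b \<tau> u * normal_density 0 (sqrt (1 + u)) x)"
    proof (cases "u \<in> {l..r}")
      case True
      then show ?thesis using ennreal_leI[OF le[OF True]] by (simp only: indicator_simps mult_1_right)
    qed simp
  qed
  finally show ?thesis .
qed

text \<open>
  The variances in \<open>[\<tau>\<^sup>2, 2 \<tau>\<^sup>2]\<close> carry prior mass bounded away from 0 and, being at most 2, they
  only widen the marginal density; hence the constant does not depend on \<open>\<tau>\<close>.
\<close>

lemma evidence_ge_null:
  "ennreal (exp (- 1 - 2 * b) / (4 * sqrt 2 * sqrt pi) * normal_density 0 1 x) \<le> evidence \<nu> x"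
proof -
  define E where "E = exp (- x\<^sup>2 / 2) / (2 * sqrt (2 * pi))"
  have t2: "\<tau>\<^sup>2 \<le> 1" using \<tau>_pos \<tau>_le_1 by (simp add: power_le_one)
  have "exp (- 1 - 2 * b) / (4 * sqrt 2 * sqrt pi) * normal_density 0 1 x
      = exp (- 1 - 2 * b) / (2 * sqrt 2 * sqrt pi) * E"
    by (simp add: normal_density_def E_def)
  also have "\<dots> \<le> exp (- 1 - b * (2 * \<tau>\<^sup>2)) / (2 * sqrt 2 * sqrt pi) * E"
    using t2 b_pos by (intro mult_right_mono divide_right_mono) (auto simp: E_def mult_left_le)
  also have "\<dots> = \<tau> / (sqrt pi * (2 * \<tau>\<^sup>2 * sqrt (2 * \<tau>\<^sup>2))) * exp (- (\<tau>\<^sup>2 / \<tau>\<^sup>2) - b * (2 * \<tau>\<^sup>2))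
      * E * (2 * \<tau>\<^sup>2 - \<tau>\<^sup>2)"
    using \<tau>_pos by (simp add: real_sqrt_mult power2_eq_square)
  finally have "ennreal (exp (- 1 - 2 * b) / (4 * sqrt 2 * sqrt pi) * normal_density 0 1 x)
    \<le> ennreal (\<tau> / (sqrt pi * (2 * \<tau>\<^sup>2 * sqrt (2 * \<tau>\<^sup>2))) * exp (- (\<tau>\<^sup>2 / \<tau>\<^sup>2) - b * (2 * \<tau>\<^sup>2))
      * E * (2 * \<tau>\<^sup>2 - \<tau>\<^sup>2))" by (rule ennreal_leI)
  also have "\<dots> \<le> evidence \<nu> x"
    using evidence_ge[of "\<tau>\<^sup>2" "2 * \<tau>\<^sup>2" 0 x] \<tau>_pos t2 by (simp add: E_def)
  finally show ?thesis .
qed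

lemma tail_const_pos: "0 < tail_const b"
  by (simp add: tail_const_def)

text \<open>
  For large \<open>x\<close> moderate variances explain the observation much better than variances up to 1 do:
  the exponent \<open>x\<^sup>2 / 6\<close> is smaller than the \<open>x\<^sup>2 / 4\<close> of the next lemma, at the price of a factor
  \<open>\<tau>\<close>.
\<close>

lemma evidence_ge_tail: "ennreal (tail_const b * \<tau> * exp (- x\<^sup>2 / 6)) \<le> evidence \<nu> x"
proof -
  have t2: "\<tau>\<^sup>2 \<le> 1" using \<tau>_pos \<tau>_le_1 by (simp add: power_le_one)
  have "tail_const b * \<tau> * exp (- x\<^sup>2 / 6)
      = \<tau> / (sqrt pi * (3 * sqrt 3)) * exp (- 1 - b * 3) * (exp (- x\<^sup>2 / 6) / (2 * sqrt (2 * pi)))"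
    by (simp add: tail_const_def mult_ac)
  also have "\<dots> \<le> \<tau> / (sqrt pi * (3 * sqrt 3)) * exp (- (\<tau>\<^sup>2 / 2) - b * 3)
      * (exp (- x\<^sup>2 / 6) / (2 * sqrt (2 * pi)))"
    using t2 \<tau>_pos by (intro mult_right_mono mult_left_mono) auto
  finally have "ennreal (tail_const b * \<tau> * exp (- x\<^sup>2 / 6))
    \<le> ennreal (\<tau> / (sqrt pi * (3 * sqrt 3)) * exp (- (\<tau>\<^sup>2 / 2) - b * 3)
      * (exp (- x\<^sup>2 / 6) / (2 * sqrt (2 * pi))))" by (rule ennreal_leI)
  also have "\<dots> \<le> evidence \<nu> x"
    using evidence_ge[of 2 3 2 x] by simp
  finally show ?thesis .
qed

lemma small_variance_le:
  "(\<integral>\<^sup>+ u. joint x u * indicator {..1} u \<partial>lborel) \<le> ennreal (exp (2 * sqrt b) * pi * exp (- x\<^sup>2 / 4))"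
proof -
  have "(\<integral>\<^sup>+ u. joint x u * indicator {..1} u \<partial>lborel)
      \<le> (\<integral>\<^sup>+ u. ennreal (ig_density b \<tau> u) * ennreal (exp (- x\<^sup>2 / 4)) \<partial>lborel)"
  proof (rule nn_integral_mono)
    fix u :: real
    show "joint x u * indicator {..1} u \<le> ennreal (ig_density b \<tau> u) * ennreal (exp (- x\<^sup>2 / 4))"
    proof (cases "0 < u \<and> u \<le> 1")
      case True
      have e: "exp (- x\<^sup>2 / (2 * (1 + u))) \<le> exp (- x\<^sup>2 / 4)"
        using True divide_left_mono[of "2 * (1 + u)" 4 "x\<^sup>2"] by simp
      have "1 * 1 \<le> (2 * pi) * (1 + u)" using True pi_gt3 by (intro mult_mono) auto
      then have s: "1 \<le> sqrt (2 * pi * (1 + u))" by (simp add: real_le_rsqrt)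
      have "normal_density 0 (sqrt (1 + u)) x = exp (- x\<^sup>2 / (2 * (1 + u))) / sqrt (2 * pi * (1 + u))"
        using True by (simp add: normal_density_def)
      also have "\<dots> \<le> exp (- x\<^sup>2 / 4) / 1"
        using e s by (intro frac_le) auto
      finally have "normal_density 0 (sqrt (1 + u)) x \<le> exp (- x\<^sup>2 / 4)" by simp
      then show ?thesis using True unfolding joint_def
        by (auto intro!: mult_left_mono ennreal_leI)
    next
      case False
      then show ?thesis
        by (auto split: split_indicator simp: joint_def ig_density_nonpos_arg)
    qed
  qed
  also have "\<dots> = (\<integral>\<^sup>+ u. ennreal (ig_density b \<tau> u) \<partial>lborel) * ennreal (exp (- x\<^sup>2 / 4))"
    by (rule nn_integral_multc) simp
  also have "\<dots> \<le> ennreal (exp (2 * sqrt b) * pi) * ennreal (exp (- x\<^sup>2 / 4))"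
    by (intro mult_right_mono ig_mass_le) simp
  finally show ?thesis by (simp add: ennreal_mult)
qed

section \<open>The posterior spread around an observation\<close>

lemma ig_has_derivative:
  assumes u: "u > 0"
  shows "(ig_density b \<tau> has_real_derivative
    ig_density b \<tau> u * (\<tau>\<^sup>2 / u\<^sup>2 - b - 3 / (2 * u))) (at u)"
proof -
  define c where "c = ig_const b \<tau> * \<tau>"
  define E where "E = exp (- (\<tau>\<^sup>2 / u) - b * u)"
  have s: "sqrt u > 0" "sqrt u * sqrt u = u" using u by simp_all
  have dE: "((\<lambda>u. exp (- (\<tau>\<^sup>2 / u) - b * u)) has_real_derivative E * (\<tau>\<^sup>2 / u\<^sup>2 - b)) (at u)"
    using u by (auto intro!: derivative_eq_intros simp: E_def power2_eq_square)
  have dP: "((\<lambda>u. c / (u * sqrt u)) has_real_derivative c / (u * sqrt u) * (- 3 / (2 * u))) (at u)"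
  proof -
    have d: "((\<lambda>u. c * (u powr (- 3 / 2))) has_real_derivative c * ((- 3 / 2) * u powr (- 3 / 2 - 1))) (at u)"
      by (intro DERIV_cmult has_real_derivative_powr u)
    have e: "y powr (- 3 / 2) = 1 / (y * sqrt y)" if "y > 0" for y :: real
      using powr_three_halves[OF that] by (simp add: powr_minus_divide)
    have "u powr (- 3 / 2 - 1) = u powr (- 3 / 2) / u"
      by (subst powr_diff) (use u in simp)
    then have "c * ((- 3 / 2) * u powr (- 3 / 2 - 1)) = c / (u * sqrt u) * (- 3 / (2 * u))"
      using e[OF u] by simp
    from DERIV_cong[OF d this] show ?thesis
      by (rule has_field_derivative_transform_within_open[where S="{0<..}"]) (use u e in auto)
  qed
  have "((\<lambda>u. c / (u * sqrt u) * exp (- (\<tau>\<^sup>2 / u) - b * u)) has_real_derivative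
      c / (u * sqrt u) * (- 3 / (2 * u)) * E + E * (\<tau>\<^sup>2 / u\<^sup>2 - b) * (c / (u * sqrt u))) (at u)"
    using DERIV_mult[OF dP dE] by (simp add: E_def)
  also have "c / (u * sqrt u) * (- 3 / (2 * u)) * E + E * (\<tau>\<^sup>2 / u\<^sup>2 - b) * (c / (u * sqrt u))
      = ig_density b \<tau> u * (\<tau>\<^sup>2 / u\<^sup>2 - b - 3 / (2 * u))"
    unfolding ig_density_eq[OF u] c_def[symmetric] E_def[symmetric] by (simp add: algebra_simps)
  finally show ?thesis
    by (rule has_field_derivative_transform_within_open[where S="{0<..}"])
       (use u in \<open>auto simp: ig_density_eq c_def\<close>)
qed

lemma marginal_has_derivative:
  assumes u: "u > 0"
  shows "((\<lambda>u. normal_density 0 (sqrt (1 + u)) x) has_real_derivative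
    normal_density 0 (sqrt (1 + u)) x * (x\<^sup>2 / (2 * (1 + u)\<^sup>2) - 1 / (2 * (1 + u)))) (at u)"
proof -
  have eq: "normal_density 0 (sqrt (1 + y)) x
      = 1 / sqrt (2 * pi) * ((1 / sqrt (1 + y)) * exp (- (x\<^sup>2 / 2) * (1 / (1 + y))))" if "y > 0" for y
    using that by (simp add: normal_density_def real_sqrt_mult)
  define S where "S = sqrt (1 + u)"
  have S: "S > 0" "1 + u = S\<^sup>2" using u by (simp_all add: S_def)
  have d1: "((\<lambda>u. 1 / sqrt (1 + u)) has_real_derivative (1 / S) * (- (1 / (2 * (1 + u))))) (at u)"
  proof -
    have "((\<lambda>u. sqrt (1 + u)) has_real_derivative inverse (sqrt (1 + u)) / 2 * 1) (at u)"
      using u by (intro DERIV_chain2[OF DERIV_real_sqrt]) (auto intro!: derivative_eq_intros)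
    from DERIV_inverse_fun[OF this] show ?thesis
      using S u by (simp add: inverse_eq_divide S_def[symmetric] power2_eq_square field_simps)
  qed
  have d2: "((\<lambda>u. exp (- (x\<^sup>2 / 2) * (1 / (1 + u)))) has_real_derivative
      exp (- (x\<^sup>2 / 2) * (1 / (1 + u))) * (x\<^sup>2 / (2 * (1 + u)\<^sup>2))) (at u)"
    using u by (auto intro!: derivative_eq_intros simp: power2_eq_square divide_simps) (simp add: algebra_simps)
  have "((\<lambda>y. 1 / sqrt (2 * pi) * ((1 / sqrt (1 + y)) * exp (- (x\<^sup>2 / 2) * (1 / (1 + y)))))
      has_real_derivative normal_density 0 (sqrt (1 + u)) x * (x\<^sup>2 / (2 * (1 + u)\<^sup>2) - 1 / (2 * (1 + u)))) (at u)"
  proof (rule DERIV_cong[OF DERIV_cmult[OF DERIV_mult[OF d1 d2]]], unfold eq[OF u] S_def)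
    have "r * (q * (- B) * E + E * A * q) = r * (q * E) * (A - B)" for r q B E A :: real
      by (simp add: algebra_simps)
    then show "1 / sqrt (2 * pi) * (1 / sqrt (1 + u) * - (1 / (2 * (1 + u))) * exp (- (x\<^sup>2 / 2) * (1 / (1 + u)))
        + exp (- (x\<^sup>2 / 2) * (1 / (1 + u))) * (x\<^sup>2 / (2 * (1 + u)\<^sup>2)) * (1 / sqrt (1 + u)))
      = 1 / sqrt (2 * pi) * (1 / sqrt (1 + u) * exp (- (x\<^sup>2 / 2) * (1 / (1 + u))))
        * (x\<^sup>2 / (2 * (1 + u)\<^sup>2) - 1 / (2 * (1 + u)))" .
  qed
  then show ?thesis
    by (rule has_field_derivative_transform_within_open[where S="{0<..}"]) (use u eq in auto)
qed

lemma ratio_sq_has_derivative: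
  assumes u: "u > (0::real)"
  shows "((\<lambda>u. (u / (1 + u))\<^sup>2) has_real_derivative (u / (1 + u))\<^sup>2 * (2 / (u * (1 + u)))) (at u)"
proof -
  have "((\<lambda>u. u / (1 + u)) has_real_derivative 1 / (1 + u)\<^sup>2) (at u)"
    using u by (auto intro!: derivative_eq_intros simp: power2_eq_square)
  from DERIV_power[OF this, of 2] show ?thesis
    by (rule DERIV_cong) (use u in \<open>simp add: power2_eq_square divide_simps\<close>)
qed

text \<open>
  The posterior of the variance satisfies \<open>\<integral> (h w)' = 0\<close> for its unnormalised density \<open>w\<close> and a weight
  \<open>h\<close>. The logarithmic derivative of \<open>w\<close> contains the wanted term \<open>x\<^sup>2 / (2 (1 + u)\<^sup>2)\<close>, the
  harmless positive term \<open>\<tau>\<^sup>2 / u\<^sup>2\<close>, and the negative terms \<open>- b\<close>, \<open>- 1 / (2 (1 + u))\<close> and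
  \<open>- 3 / (2 u)\<close>. Only the last one is unbounded; the weight \<open>h = (u / (1 + u))\<^sup>2\<close> tames it
  at 0, stays below 1, and is increasing, so that its own derivative has the favourable sign. It is
  here that the factor \<open>exp (- b u)\<close> is seen not to over-shrink large observations: it contributes just
  the constant \<open>b\<close>, whatever \<open>x\<close>.
\<close>

lemma by_parts_bound:
  "(\<integral>\<^sup>+ u. joint x u * ennreal (x\<^sup>2 * u\<^sup>2 / (1 + u) ^ 4) \<partial>lborel) \<le> ennreal (2 * b + 4) * evidence \<nu> x"
proof -
  define w where "w u = ig_density b \<tau> u * normal_density 0 (sqrt (1 + u)) x" for u
  define h where "h u = (u / (1 + u))\<^sup>2" for u :: real
  define P where "P u = h u * w u * (x\<^sup>2 / (2 * (1 + u)\<^sup>2) + \<tau>\<^sup>2 / u\<^sup>2 + 2 / (u * (1 + u)))" for u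
  define Q where "Q u = h u * w u * (b + 1 / (2 * (1 + u)) + 3 / (2 * u))" for u
  have w_nonneg: "0 \<le> w u" for u by (simp add: w_def ig_density_nonneg)
  have h_nonneg: "0 \<le> h u" for u by (simp add: h_def)
  have joint_w: "joint x u = ennreal (w u)" for u by (simp add: joint_real w_def)
  have w_meas [measurable]: "w \<in> borel_measurable borel" unfolding w_def[abs_def] by measurable
  have h_meas [measurable]: "h \<in> borel_measurable borel" unfolding h_def[abs_def] by measurable
  have dw: "(w has_real_derivative
      w u * (\<tau>\<^sup>2 / u\<^sup>2 - b - 3 / (2 * u) + (x\<^sup>2 / (2 * (1 + u)\<^sup>2) - 1 / (2 * (1 + u))))) (at u)"
    if "u > 0" for u
    using DERIV_mult[OF ig_has_derivative[OF that] marginal_has_derivative[OF that, of x]]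
    unfolding w_def by (rule DERIV_cong) (simp add: algebra_simps)
  have dF: "((\<lambda>u. h u * w u) has_real_derivative P u - Q u) (at u)" if "u > 0" for u
    using DERIV_mult[OF ratio_sq_has_derivative[OF that, folded h_def] dw[OF that]]
    by (rule DERIV_cong) (simp add: P_def Q_def algebra_simps)
  have cw: "isCont w u" and ch: "isCont h u" if "u > 0" for u
    using DERIV_isCont[OF dw[OF that]] DERIV_isCont[OF ratio_sq_has_derivative[OF that, folded h_def]] by auto
  have h_le: "h u \<le> 1" and h_div_le: "h u / u \<le> 1" if "u > 0" for u
  proof -
    have "u / (1 + u) \<le> 1" "0 \<le> u / (1 + u)" using that by auto
    then show "h u \<le> 1" unfolding h_def by (rule power_le_one[rotated])
    have "h u / u = u / (1 + u) * (1 / (1 + u))"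
      using that by (simp add: h_def power2_eq_square)
    also have "\<dots> \<le> 1 * 1" using that by (intro mult_mono) auto
    finally show "h u / u \<le> 1" by simp
  qed
  have lim: "((\<lambda>u. h u * w u) \<longlongrightarrow> 0) at_top"
  proof (rule tendsto_sandwich[OF _ _ tendsto_const])
    show "eventually (\<lambda>u. 0 \<le> h u * w u) at_top"
      by (intro always_eventually allI mult_nonneg_nonneg h_nonneg w_nonneg)
    show "eventually (\<lambda>u. h u * w u \<le> ig_const b \<tau> * \<tau> * exp (- (b * u))) at_top"
      using eventually_ge_at_top[of 1]
    proof eventually_elim
      case (elim u)
      then have u: "u > 0" by simp
      have "1 * 1 \<le> u * sqrt u" using elim by (intro mult_mono) auto
      then have "ig_const b \<tau> * \<tau> / (u * sqrt u) \<le> ig_const b \<tau> * \<tau> / 1"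
        using ig_const_pos \<tau>_pos by (intro divide_left_mono) auto
      moreover have "exp (- (\<tau>\<^sup>2 / u) - b * u) \<le> exp (- (b * u))" using u by simp
      ultimately have 1: "ig_density b \<tau> u \<le> ig_const b \<tau> * \<tau> * exp (- (b * u))"
        unfolding ig_density_eq[OF u] using ig_const_pos \<tau>_pos u by (intro mult_mono) auto
      have "1 * 1 \<le> (2 * pi) * (1 + u)" using u pi_gt3 by (intro mult_mono) auto
      then have "1 \<le> sqrt (2 * pi * (1 + u))" by (simp add: real_le_rsqrt)
      then have "exp (- x\<^sup>2 / (2 * (1 + u))) / sqrt (2 * pi * (1 + u)) \<le> 1 / 1"
        using u by (intro frac_le) auto
      then have 2: "normal_density 0 (sqrt (1 + u)) x \<le> 1"
        using u by (simp add: normal_density_def)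
      have "w u \<le> ig_density b \<tau> u * 1"
        unfolding w_def by (intro mult_left_mono 2 ig_density_nonneg)
      then have "h u * w u \<le> 1 * (ig_const b \<tau> * \<tau> * exp (- (b * u)))"
        using 1 h_le[OF u] w_nonneg h_nonneg by (intro mult_mono) auto
      then show ?case by simp
    qed
    have "filterlim (\<lambda>u. b * u) at_top at_top"
      by (rule filterlim_tendsto_pos_mult_at_top[OF tendsto_const b_pos filterlim_ident])
    then have "((\<lambda>u. exp (- (b * u))) \<longlongrightarrow> 0) at_top"
      by (intro filterlim_compose[OF exp_at_bot]) (simp add: filterlim_uminus_at_bot)
    from tendsto_mult[OF tendsto_const this, of "ig_const b \<tau> * \<tau>"]
    show "((\<lambda>u. ig_const b \<tau> * \<tau> * exp (- (b * u))) \<longlongrightarrow> 0) at_top" by simp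
  qed
  have P_ge: "x\<^sup>2 * u\<^sup>2 / (1 + u) ^ 4 * w u \<le> 2 * P u" if "u > 0" for u
  proof -
    have "(1 + u) ^ 4 = (1 + u)\<^sup>2 * (1 + u)\<^sup>2" by (simp add: power2_eq_square power4_eq_xxxx)
    then have "x\<^sup>2 * u\<^sup>2 / (1 + u) ^ 4 * w u = 2 * (h u * w u * (x\<^sup>2 / (2 * (1 + u)\<^sup>2)))"
      by (simp add: h_def power_divide)
    also have "\<dots> \<le> 2 * P u"
      unfolding P_def using that w_nonneg h_nonneg by (intro mult_left_mono) auto
    finally show ?thesis .
  qed
  have Q_le: "2 * Q u \<le> (2 * b + 4) * w u" if "u > 0" for u
  proof -
    have "h u * (1 / (2 * (1 + u))) \<le> 1 * (1 / 2)"
      using that h_le h_nonneg by (intro mult_mono frac_le) auto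
    moreover have "h u * b \<le> b" using h_le[OF that] b_pos by (simp add: mult_left_le_one_le h_nonneg)
    moreover have "h u * (3 / (2 * u)) = 3 / 2 * (h u / u)" by simp
    ultimately have "h u * (b + 1 / (2 * (1 + u)) + 3 / (2 * u)) \<le> b + 2"
      using h_div_le[OF that] unfolding distrib_left by linarith
    from mult_right_mono[OF this w_nonneg[of u]] have "Q u \<le> (b + 2) * w u"
      by (simp only: Q_def mult.commute mult.left_commute)
    then show ?thesis by (simp add: distrib_right)
  qed
  have "(\<integral>\<^sup>+ u. joint x u * ennreal (x\<^sup>2 * u\<^sup>2 / (1 + u) ^ 4) \<partial>lborel)
      \<le> (\<integral>\<^sup>+ u. 2 * (ennreal (P u) * indicator {0<..} u) \<partial>lborel)"
  proof (rule nn_integral_mono)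
    fix u :: real
    show "joint x u * ennreal (x\<^sup>2 * u\<^sup>2 / (1 + u) ^ 4) \<le> 2 * (ennreal (P u) * indicator {0<..} u)"
    proof (cases "u > 0")
      case True
      then have "joint x u * ennreal (x\<^sup>2 * u\<^sup>2 / (1 + u) ^ 4) = ennreal (x\<^sup>2 * u\<^sup>2 / (1 + u) ^ 4 * w u)"
        using w_nonneg by (simp add: joint_w ennreal_mult[symmetric] mult.commute)
      also have "\<dots> \<le> ennreal (2 * P u)" by (intro ennreal_leI P_ge True)
      finally show ?thesis using True by (simp add: ennreal_mult')
    qed (simp add: joint_def ig_density_nonpos_arg)
  qed
  also have "\<dots> = 2 * (\<integral>\<^sup>+ u. ennreal (P u) * indicator {0<..} u \<partial>lborel)"
    by (rule nn_integral_cmult) (simp add: P_def)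
  also have "\<dots> \<le> 2 * ((\<integral>\<^sup>+ u. ennreal (Q u) * indicator {0<..} u \<partial>lborel) + ennreal 0)"
  proof (rule mult_left_mono[OF nn_integral_le_by_parts[OF dF]])
    fix u :: real assume u: "0 < u"
    show "isCont P u" "isCont Q u"
      unfolding P_def[abs_def] Q_def[abs_def] using u cw[OF u] ch[OF u]
      by (auto intro!: continuous_intros)
    show "0 \<le> h u * w u" "0 \<le> P u" "0 \<le> Q u"
      unfolding P_def Q_def using u b_pos w_nonneg h_nonneg
      by (auto intro!: mult_nonneg_nonneg add_nonneg_nonneg)
  next
    show "P \<in> borel_measurable borel" "Q \<in> borel_measurable borel"
      unfolding P_def[abs_def] Q_def[abs_def] by measurable
  qed (use lim in auto)
  also have "\<dots> = (\<integral>\<^sup>+ u. 2 * (ennreal (Q u) * indicator {0<..} u) \<partial>lborel)"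
    by (subst nn_integral_cmult) (simp_all add: Q_def)
  also have "\<dots> \<le> (\<integral>\<^sup>+ u. ennreal (2 * b + 4) * joint x u \<partial>lborel)"
  proof (rule nn_integral_mono)
    fix u :: real
    show "2 * (ennreal (Q u) * indicator {0<..} u) \<le> ennreal (2 * b + 4) * joint x u"
    proof (cases "u > 0")
      case True
      have "2 * ennreal (Q u) = ennreal (2 * Q u)" by (simp add: ennreal_mult')
      also have "\<dots> \<le> ennreal ((2 * b + 4) * w u)" by (intro ennreal_leI Q_le True)
      also have "\<dots> = ennreal (2 * b + 4) * joint x u"
        using b_pos by (subst ennreal_mult) (auto simp: joint_w w_nonneg)
      finally show ?thesis using True by simp
    qed simp
  qed
  also have "\<dots> = ennreal (2 * b + 4) * evidence \<nu> x"
    unfolding evidence_ig by (rule nn_integral_cmult) simp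
  finally show ?thesis .
qed

text \<open>
  For \<open>x\<^sup>2 \<le> 24 L\<close> the trivial bound by the evidence suffices. Beyond that, the ratio of
  \<open>small_variance_le\<close> to \<open>evidence_ge_tail\<close> is of order \<open>exp (- x\<^sup>2 / 12) / \<tau>\<close>; one half of the exponent absorbs the factor \<open>x\<^sup>2\<close>, and the
  other half, being at most \<open>exp (- L)\<close>, absorbs \<open>1 / \<tau>\<close>.
\<close>

lemma small_variance_weight_le:
  assumes AL: "0 \<le> L" and C0: "exp (- L) \<le> C0 * \<tau>"
  shows "ennreal (x\<^sup>2) * (\<integral>\<^sup>+ u. joint x u * indicator {..1} u \<partial>lborel)
    \<le> ennreal (24 * L + 24 * (exp (2 * sqrt b) * pi) * C0 / tail_const b) * evidence \<nu> x"
    (is "_ * ?S \<le> ennreal (_ + ?D) * _")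
proof -
  define k where "k = exp (2 * sqrt b) * pi"
  have k: "k > 0" by (simp add: k_def)
  have C0_pos: "C0 > 0"
  proof -
    have "0 < C0 * \<tau>" using C0 by (rule less_le_trans[OF exp_gt_zero])
    then show ?thesis using \<tau>_pos by (simp add: zero_less_mult_iff)
  qed
  have D: "0 \<le> ?D" using C0_pos tail_const_pos by simp
  show ?thesis
  proof (cases "x\<^sup>2 \<le> 24 * L")
    case True
    have "?S \<le> evidence \<nu> x"
      unfolding evidence_ig by (intro nn_integral_mono) (auto split: split_indicator)
    then have "ennreal (x\<^sup>2) * ?S \<le> ennreal (24 * L + ?D) * evidence \<nu> x"
      using True D by (intro mult_mono ennreal_leI) auto
    then show ?thesis .
  next
    case False
    \<comment> \<open>In this unit the exponent \<open>x\<^sup>2 / 4\<close> splits as \<open>y + y + 4 * y\<close>: one \<open>y\<close> for \<open>x\<^sup>2\<close>, one for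
      \<open>1 / \<tau>\<close>, and \<open>4 * y = x\<^sup>2 / 6\<close> for the evidence.\<close>
    define y where "y = x\<^sup>2 / 24"
    have y: "0 \<le> y" "L \<le> y" "x\<^sup>2 = 24 * y" using False by (auto simp: y_def)
    have "y * exp (- y) \<le> 1"
    proof -
      have "y * exp (- y) \<le> y * (1 / (1 + y))" using y by (intro mult_left_mono exp_minus_le_inverse) auto
      also have "\<dots> \<le> 1" using y by (simp add: field_simps)
      finally show ?thesis .
    qed
    moreover have "exp (- y) \<le> C0 * \<tau>" using y C0 by (intro order_trans[OF _ C0]) simp
    ultimately have "(y * exp (- y)) * exp (- y) \<le> 1 * (C0 * \<tau>)"
      using y by (intro mult_mono) auto
    then have "24 * k * (((y * exp (- y)) * exp (- y)) * exp (- (4 * y))) \<le> 24 * k * ((C0 * \<tau>) * exp (- (4 * y)))"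
      using k by (intro mult_left_mono mult_right_mono) auto
    also have "\<dots> = ?D * (tail_const b * \<tau> * exp (- x\<^sup>2 / 6))"
      using tail_const_pos y by (simp add: k_def)
    also have "24 * k * (((y * exp (- y)) * exp (- y)) * exp (- (4 * y))) = x\<^sup>2 * (k * exp (- x\<^sup>2 / 4))"
      using y by (simp add: mult.assoc exp_add[symmetric])
    finally have real: "x\<^sup>2 * (k * exp (- x\<^sup>2 / 4)) \<le> ?D * (tail_const b * \<tau> * exp (- x\<^sup>2 / 6))" .
    have "ennreal (x\<^sup>2) * ?S \<le> ennreal (x\<^sup>2) * ennreal (k * exp (- x\<^sup>2 / 4))"
      unfolding k_def by (intro mult_left_mono small_variance_le) simp
    also have "\<dots> = ennreal (x\<^sup>2 * (k * exp (- x\<^sup>2 / 4)))"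
      using k by (simp add: ennreal_mult)
    also have "\<dots> \<le> ennreal (?D * (tail_const b * \<tau> * exp (- x\<^sup>2 / 6)))"
      by (intro ennreal_leI real)
    also have "\<dots> = ennreal ?D * ennreal (tail_const b * \<tau> * exp (- x\<^sup>2 / 6))"
      by (rule ennreal_mult[OF D]) (use tail_const_pos \<tau>_pos in simp)
    also have "\<dots> \<le> ennreal (24 * L + ?D) * evidence \<nu> x"
      using AL by (intro mult_mono ennreal_leI evidence_ge_tail) auto
    finally show ?thesis .
  qed
qed

text \<open>
  Given \<open>u\<close>, the posterior shrinks \<open>x\<close> by \<open>x / (1 + u)\<close>, so the squared bias \<open>x\<^sup>2 / (1 + u)\<^sup>2\<close> has to
  be controlled. It is at most \<open>x\<^sup>2\<close> if \<open>u \<le> 1\<close>, and otherwise at most \<open>4 x\<^sup>2 u\<^sup>2 / (1 + u)\<^sup>4\<close>, because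
  then \<open>1 + u \<le> 2 u\<close>.
\<close>

lemma posterior_second_moment_le:
  assumes AL: "0 \<le> L" and C0: "exp (- L) \<le> C0 * \<tau>"
  shows "(\<integral>\<^sup>+ t. ennreal ((t - x)\<^sup>2) * ennreal (normal_density t 1 x) \<partial>\<nu>)
    \<le> ennreal (17 + 8 * b + 24 * L + 24 * (exp (2 * sqrt b) * pi) * C0 / tail_const b) * evidence \<nu> x"
    (is "_ \<le> ennreal (17 + 8 * b + 24 * L + ?D) * _")
proof -
  let ?S = "\<integral>\<^sup>+ u. joint x u * indicator {..1} u \<partial>lborel"
  have D: "0 \<le> ?D"
  proof -
    have "0 < C0 * \<tau>" using C0 by (rule less_le_trans[OF exp_gt_zero])
    then have "0 < C0" using \<tau>_pos by (simp add: zero_less_mult_iff)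
    then show ?thesis using tail_const_pos by simp
  qed
  have pw: "joint x u * ennreal (u / (1 + u) + x\<^sup>2 / (1 + u)\<^sup>2)
      \<le> joint x u + (ennreal (x\<^sup>2) * (joint x u * indicator {..1} u)
          + 4 * (joint x u * ennreal (x\<^sup>2 * u\<^sup>2 / (1 + u) ^ 4)))" for u
  proof (cases "u > 0")
    case True
    define v where "v = x\<^sup>2 * u\<^sup>2 / (1 + u) ^ 4"
    have v: "0 \<le> v" by (simp add: v_def)
    have "u / (1 + u) + x\<^sup>2 / (1 + u)\<^sup>2 \<le> 1 + (x\<^sup>2 * indicator {..1} u + 4 * v)"
    proof (cases "u \<le> 1")
      case le: True
      have "x\<^sup>2 / (1 + u)\<^sup>2 \<le> x\<^sup>2 / 1" using True by (intro divide_left_mono) auto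
      moreover have "u / (1 + u) \<le> 1" using True by simp
      ultimately show ?thesis using le v by simp
    next
      case False
      have "(1 + u)\<^sup>2 \<le> (2 * u)\<^sup>2" using False by (intro power_mono) auto
      then have "x\<^sup>2 * (1 + u)\<^sup>2 \<le> x\<^sup>2 * (2 * u)\<^sup>2" by (rule mult_left_mono) simp
      then have "x\<^sup>2 * (1 + u)\<^sup>2 / (1 + u) ^ 4 \<le> x\<^sup>2 * (2 * u)\<^sup>2 / (1 + u) ^ 4"
        using True by (intro divide_right_mono) auto
      moreover have "x\<^sup>2 * (1 + u)\<^sup>2 / (1 + u) ^ 4 = x\<^sup>2 / (1 + u)\<^sup>2"
        using True by (simp add: power4_eq_xxxx power2_eq_square)
      moreover have "x\<^sup>2 * (2 * u)\<^sup>2 / (1 + u) ^ 4 = 4 * v" by (simp add: v_def power_mult_distrib)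
      moreover have "u / (1 + u) \<le> 1" using True by simp
      moreover have "x\<^sup>2 * indicator {..1} u = 0" using False by simp
      ultimately show ?thesis by linarith
    qed
    then have "ennreal (u / (1 + u) + x\<^sup>2 / (1 + u)\<^sup>2)
        \<le> ennreal (1 + (x\<^sup>2 * indicator {..1} u + 4 * v))" by (rule ennreal_leI)
    also have "\<dots> = 1 + (ennreal (x\<^sup>2) * indicator {..1} u + 4 * ennreal v)"
      using v by (simp add: ennreal_mult' split: split_indicator)
    finally have "joint x u * ennreal (u / (1 + u) + x\<^sup>2 / (1 + u)\<^sup>2)
        \<le> joint x u * (1 + (ennreal (x\<^sup>2) * indicator {..1} u + 4 * ennreal v))"
      by (rule mult_left_mono) simp
    then show ?thesis by (simp add: v_def distrib_left mult_ac)
  qed (simp add: joint_def ig_density_nonpos_arg)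
  have "(\<integral>\<^sup>+ t. ennreal ((t - x)\<^sup>2) * ennreal (normal_density t 1 x) \<partial>\<nu>)
      = (\<integral>\<^sup>+ u. joint x u * ennreal (u / (1 + u) + x\<^sup>2 / (1 + u)\<^sup>2) \<partial>lborel)"
    by (rule second_moment_joint) (rule ig_density_nonpos_arg)
  also have "\<dots> \<le> (\<integral>\<^sup>+ u. joint x u + (ennreal (x\<^sup>2) * (joint x u * indicator {..1} u)
          + 4 * (joint x u * ennreal (x\<^sup>2 * u\<^sup>2 / (1 + u) ^ 4))) \<partial>lborel)"
    by (intro nn_integral_mono pw)
  also have "\<dots> = evidence \<nu> x + (ennreal (x\<^sup>2) * ?S
      + 4 * (\<integral>\<^sup>+ u. joint x u * ennreal (x\<^sup>2 * u\<^sup>2 / (1 + u) ^ 4) \<partial>lborel))"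
    by (simp add: nn_integral_add nn_integral_cmult evidence_ig)
  also have "\<dots> \<le> evidence \<nu> x + (ennreal (24 * L + ?D) * evidence \<nu> x
      + 4 * (ennreal (2 * b + 4) * evidence \<nu> x))"
    by (intro add_left_mono add_mono mult_left_mono small_variance_weight_le assms by_parts_bound) simp
  also have "\<dots> = (ennreal 1 + (ennreal (24 * L + ?D) + ennreal 4 * ennreal (2 * b + 4))) * evidence \<nu> x"
    by (simp add: distrib_right mult.assoc)
  also have "ennreal 1 + (ennreal (24 * L + ?D) + ennreal 4 * ennreal (2 * b + 4))
      = ennreal (1 + ((24 * L + ?D) + 4 * (2 * b + 4)))"
    using AL D b_pos by (simp only: ennreal_plus ennreal_mult add_nonneg_nonneg mult_nonneg_nonneg zero_le_numeral zero_le_one less_imp_le)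
  also have "1 + ((24 * L + ?D) + 4 * (2 * b + 4)) = 17 + 8 * b + 24 * L + ?D" by simp
  finally show ?thesis .
qed

end

section \<open>The total risk over sparse vectors\<close>

definition null_const :: "real \<Rightarrow> real" where
  "null_const b = 4 * sqrt 2 * sqrt pi / exp (- 1 - 2 * b) * (exp (2 * sqrt b) * pi / sqrt b)"

definition signal_const :: "real \<Rightarrow> real \<Rightarrow> real \<Rightarrow> real" where
  "signal_const b K C0 =
     2 * (17 + 8 * b + 24 * K + 24 * (exp (2 * sqrt b) * pi) * C0 / tail_const b) + 2"

context inverse_gaussian begin

lemma risk_at_zero: "(\<integral>\<^sup>+ x. post_risk \<nu> 0 x \<partial>normal_law 0 1) \<le> ennreal (null_const b * \<tau>)"
proof -
  define c where "c = exp (- 1 - 2 * b) / (4 * sqrt 2 * sqrt pi)"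
  have c: "c > 0" by (simp add: c_def)
  have "(\<integral>\<^sup>+ t. ennreal (t\<^sup>2) \<partial>\<nu>) \<le> ennreal (exp (2 * sqrt b) * pi / sqrt b * \<tau>)"
    using ig_mean_le by (subst prior_second_moment) (auto simp: ig_density_nonpos_arg)
  then have "(\<integral>\<^sup>+ x. post_risk \<nu> 0 x \<partial>normal_law 0 1)
      \<le> ennreal (1 / c) * ennreal (exp (2 * sqrt b) * pi / sqrt b * \<tau>)"
    using risk_at_zero_le[OF c evidence_ge_null[folded c_def]]
    by (elim order_trans) (rule mult_left_mono, simp_all)
  also have "\<dots> = ennreal (1 / c * (exp (2 * sqrt b) * pi / sqrt b * \<tau>))"
    using c b_pos \<tau>_pos by (intro ennreal_mult[symmetric]) auto
  also have "1 / c * (exp (2 * sqrt b) * pi / sqrt b * \<tau>) = null_const b * \<tau>"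
    by (simp add: null_const_def c_def)
  finally show ?thesis .
qed

lemma risk_anywhere:
  assumes L: "1 \<le> L" and K: "0 \<le> K" and C0: "exp (- (K * L)) \<le> C0 * \<tau>"
  shows "(\<integral>\<^sup>+ x. post_risk \<nu> a x \<partial>normal_law a 1) \<le> ennreal (signal_const b K C0 * L)"
proof -
  define D where "D = 24 * (exp (2 * sqrt b) * pi) * C0 / tail_const b"
  have "0 < C0 * \<tau>" using C0 by (rule less_le_trans[OF exp_gt_zero])
  then have "0 < C0" using \<tau>_pos by (simp add: zero_less_mult_iff)
  then have D: "0 \<le> D" using tail_const_pos by (simp add: D_def)
  have KL: "0 \<le> K * L" using K L by simp
  have "(\<integral>\<^sup>+ x. post_risk \<nu> a x \<partial>normal_law a 1) \<le> ennreal (2 * (17 + 8 * b + 24 * (K * L) + D) + 2)"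
    using posterior_second_moment_le[OF KL C0] D KL b_pos unfolding D_def
    by (intro risk_le) auto
  also have "\<dots> \<le> ennreal (signal_const b K C0 * L)"
  proof (rule ennreal_leI)
    have "(17 + 8 * b + D) * 1 \<le> (17 + 8 * b + D) * L"
      using L D b_pos by (intro mult_left_mono) auto
    then show "2 * (17 + 8 * b + 24 * (K * L) + D) + 2 \<le> signal_const b K C0 * L"
      using L unfolding signal_const_def D_def[symmetric] by (simp add: algebra_simps)
  qed
  finally show ?thesis .
qed

lemma total_risk_le:
  assumes \<theta>: "\<theta> \<in> sparse_vectors n s" and L: "1 \<le> L" and K: "0 \<le> K"
    and C0: "exp (- (K * L)) \<le> C0 * \<tau>" and \<tau>_le: "real n * \<tau> \<le> s * L"
  shows "(\<Sum>i<n. \<integral>\<^sup>+ x. post_risk \<nu> (\<theta> i) x \<partial>normal_law (\<theta> i) 1)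
    \<le> ennreal ((null_const b + signal_const b K C0) * (s * L))"
proof -
  define N where "N = {i \<in> {..<n}. \<theta> i \<noteq> 0}"
  have N: "N \<subseteq> {..<n}" "real (card N) \<le> s" using \<theta> by (auto simp: sparse_vectors_def N_def)
  have null: "0 \<le> null_const b" using b_pos by (simp add: null_const_def)
  have "0 < C0 * \<tau>" using C0 by (rule less_le_trans[OF exp_gt_zero])
  then have "0 < C0" using \<tau>_pos by (simp add: zero_less_mult_iff)
  then have signal: "0 \<le> signal_const b K C0"
    using b_pos K tail_const_pos by (simp add: signal_const_def)
  have "(\<Sum>i<n. \<integral>\<^sup>+ x. post_risk \<nu> (\<theta> i) x \<partial>normal_law (\<theta> i) 1)
      \<le> (\<Sum>i<n. ennreal (null_const b * \<tau> + (if i \<in> N then signal_const b K C0 * L else 0)))"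
  proof (rule sum_mono)
    fix i assume i: "i \<in> {..<n}"
    show "(\<integral>\<^sup>+ x. post_risk \<nu> (\<theta> i) x \<partial>normal_law (\<theta> i) 1)
        \<le> ennreal (null_const b * \<tau> + (if i \<in> N then signal_const b K C0 * L else 0))"
    proof (cases "i \<in> N")
      case True
      have "ennreal (signal_const b K C0 * L) \<le> ennreal (null_const b * \<tau> + signal_const b K C0 * L)"
        using null \<tau>_pos by (intro ennreal_leI) simp
      with True show ?thesis using order_trans[OF risk_anywhere[OF L K C0]] by simp
    next
      case False
      then have "\<theta> i = 0" using i by (simp add: N_def)
      then show ?thesis using risk_at_zero False by simp
    qed
  qed
  also have "\<dots> = ennreal (\<Sum>i<n. null_const b * \<tau> + (if i \<in> N then signal_const b K C0 * L else 0))"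
    using null signal \<tau>_pos L by (intro sum_ennreal add_nonneg_nonneg) auto
  also have "(\<Sum>i<n. null_const b * \<tau> + (if i \<in> N then signal_const b K C0 * L else 0))
      = null_const b * (real n * \<tau>) + signal_const b K C0 * (real (card N) * L)"
    using N by (simp add: sum.distrib sum.If_cases Int_absorb1 mult_ac)
  also have "ennreal \<dots> \<le> ennreal ((null_const b + signal_const b K C0) * (s * L))"
  proof (rule ennreal_leI)
    have "real (card N) * L \<le> s * L" using N L by (intro mult_right_mono) auto
    then have "null_const b * (real n * \<tau>) + signal_const b K C0 * (real (card N) * L)
        \<le> null_const b * (s * L) + signal_const b K C0 * (s * L)"
      using \<tau>_le null signal by (intro add_mono mult_left_mono) auto
    then show "null_const b * (real n * \<tau>) + signal_const b K C0 * (real (card N) * L)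
        \<le> (null_const b + signal_const b K C0) * (s * L)"
      by (simp add: distrib_right)
  qed
  finally show ?thesis .
qed

end

theorem mainTheorem3:
  fixes p \<tau> :: "nat \<Rightarrow> real" and b K :: real
  assumes p_range: "eventually (\<lambda>n. 0 < p n \<and> p n < real n) sequentially"
    and p_sparse: "p \<in> o(\<lambda>n. real n)"
    and b_pos: "b > 0"
    and tau_pos: "eventually (\<lambda>n. \<tau> n > 0) sequentially"
    and K_gt: "K > 1"
    and tau_lower: "\<exists>C. eventually (\<lambda>n. (p n / real n) powr K \<le> C * \<tau> n) sequentially"
    and tau_upper:
      "eventually (\<lambda>n. \<tau> n \<le> p n / real n * sqrt (ln (real n / p n))) sequentially"
  shows
    "(\<forall>M :: nat \<Rightarrow> real. (\<forall>n. M n > 0) \<longrightarrow> filterlim M at_top sequentially \<longrightarrow>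
        (\<lambda>n. SUP \<theta>0 \<in> sparse_vectors n (p n).
            \<integral>\<^sup>+ X. emeasure (posterior n (ig_density b (\<tau> n)) X)
                 {\<theta> \<in> space (posterior n (ig_density b (\<tau> n)) X).
                    sq_dist n \<theta> \<theta>0 > M n * p n * ln (real n / p n)}
              \<partial>obs_law n \<theta>0) \<longlonglongrightarrow> 0)
     \<and> (\<exists>C. eventually (\<lambda>n.
          (SUP \<theta>0 \<in> sparse_vectors n (p n).
            \<integral>\<^sup>+ X. ennreal (sq_dist n (posterior_mean n (ig_density b (\<tau> n)) X) \<theta>0)
              \<partial>obs_law n \<theta>0)
          \<le> ennreal (C * (p n * ln (real n / p n)))) sequentially)"
proof -
  obtain C0 where C0: "eventually (\<lambda>n. (p n / real n) powr K \<le> C0 * \<tau> n) sequentially"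
    using tau_lower by blast
  define L where "L n = ln (real n / p n)" for n
  define C where "C = null_const b + signal_const b K C0"
  have small: "eventually (\<lambda>n. norm (p n) \<le> exp (- 1) * norm (real n)) sequentially"
    using landau_o.smallD[OF p_sparse, of "exp (- 1)"] by simp
  have good: "eventually (\<lambda>n. 0 < p n \<and> 1 \<le> L n \<and> inverse_gaussian b (\<tau> n)
      \<and> exp (- (K * L n)) \<le> C0 * \<tau> n \<and> real n * \<tau> n \<le> p n * L n) sequentially"
    using p_range small tau_pos C0 tau_upper
  proof eventually_elim
    case (elim n)
    then have p: "0 < p n" "0 < real n" by auto
    \<comment> \<open>\<open>L n \<ge> 1\<close> lets constants be absorbed into \<open>L n\<close>, and \<open>sqrt (L n) \<le> L n\<close>; so the upper
      bound on \<open>\<tau> n\<close> yields both \<open>\<tau> n \<le> 1\<close> and the budget for the null coordinates.\<close>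
    have "exp 1 * p n \<le> real n"
      using elim p by (simp add: exp_minus field_simps)
    then have "exp 1 \<le> real n / p n" using p by (simp add: field_simps)
    then have L1: "1 \<le> L n" using p by (simp add: L_def ln_ge_iff)
    have "sqrt (L n) \<le> L n"
      using L1 by (intro real_le_lsqrt) (auto simp: power2_eq_square)
    then have le: "\<tau> n \<le> p n / real n * L n"
      using elim p by (elim conjE order_trans) (auto simp: L_def intro!: divide_right_mono mult_left_mono)
    have "L n \<le> real n / p n" unfolding L_def
      using ln_le_minus_one[of "real n / p n"] p by simp
    then have "p n / real n * L n \<le> p n / real n * (real n / p n)"
      using p by (intro mult_left_mono) auto
    then have "p n / real n * L n \<le> 1" using p by simp
    then have "\<tau> n \<le> 1" using le by linarith
    then have ig: "inverse_gaussian b (\<tau> n)"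
      using elim b_pos by unfold_locales auto
    have "exp (- (K * L n)) = (p n / real n) powr K"
      using p by (simp add: L_def powr_def ln_div algebra_simps)
    then have low: "exp (- (K * L n)) \<le> C0 * \<tau> n" using elim by simp
    have "real n * \<tau> n \<le> real n * (p n / real n * L n)" using le p by (intro mult_left_mono) auto
    also have "\<dots> = p n * L n" using p by simp
    finally show ?case using p L1 ig low by simp
  qed
  have tail: "(\<lambda>n. SUP \<theta>0 \<in> sparse_vectors n (p n).
            \<integral>\<^sup>+ X. emeasure (posterior n (ig_density b (\<tau> n)) X)
                 {\<theta> \<in> space (posterior n (ig_density b (\<tau> n)) X).
                    sq_dist n \<theta> \<theta>0 > M n * p n * ln (real n / p n)}
              \<partial>obs_law n \<theta>0) \<longlonglongrightarrow> 0" (is "?T \<longlonglongrightarrow> 0")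
    if M: "\<And>n. M n > 0" "filterlim M at_top sequentially" for M
  proof (rule tendsto_sandwich[OF _ _ tendsto_const])
    show "eventually (\<lambda>n. 0 \<le> ?T n) sequentially" by simp
    show "eventually (\<lambda>n. ?T n \<le> ennreal (C / M n)) sequentially"
      using good
    proof eventually_elim
      case (elim n)
      then interpret inverse_gaussian b "\<tau> n" by simp
      have r: "0 < M n * p n * L n" using elim M(1)[of n] by simp
      show ?case
      proof (rule SUP_least)
        fix \<theta>0 assume \<theta>0: "\<theta>0 \<in> sparse_vectors n (p n)"
        have "(\<integral>\<^sup>+ X. emeasure (posterior n (ig_density b (\<tau> n)) X)
              {\<theta> \<in> space (posterior n (ig_density b (\<tau> n)) X). sq_dist n \<theta> \<theta>0 > M n * p n * L n}
              \<partial>obs_law n \<theta>0)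
            \<le> ennreal (1 / (M n * p n * L n))
                * (\<Sum>i<n. \<integral>\<^sup>+ x. post_risk (scale_mixture (ig_density b (\<tau> n))) (\<theta>0 i) x \<partial>normal_law (\<theta>0 i) 1)"
          by (rule expected_posterior_tail_le[OF r])
        also have "\<dots> \<le> ennreal (1 / (M n * p n * L n)) * ennreal (C * (p n * L n))"
          unfolding C_def using elim K_gt \<theta>0 by (intro mult_left_mono total_risk_le) auto
        also have "\<dots> = ennreal (1 / (M n * p n * L n) * (C * (p n * L n)))"
          using r by (intro ennreal_mult'[symmetric]) simp
        also have "1 / (M n * p n * L n) * (C * (p n * L n)) = C / M n"
          using r elim by auto
        finally show "(\<integral>\<^sup>+ X. emeasure (posterior n (ig_density b (\<tau> n)) X)
              {\<theta> \<in> space (posterior n (ig_density b (\<tau> n)) X).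
                 sq_dist n \<theta> \<theta>0 > M n * p n * ln (real n / p n)} \<partial>obs_law n \<theta>0) \<le> ennreal (C / M n)"
          by (simp only: L_def)
      qed
    qed
    have "(\<lambda>n. C / M n) \<longlonglongrightarrow> 0"
      by (rule real_tendsto_divide_at_top[OF tendsto_const M(2)])
    from tendsto_ennrealI[OF this] show "(\<lambda>n. ennreal (C / M n)) \<longlonglongrightarrow> 0" by simp
  qed
  have mean: "eventually (\<lambda>n. (SUP \<theta>0 \<in> sparse_vectors n (p n).
            \<integral>\<^sup>+ X. ennreal (sq_dist n (posterior_mean n (ig_density b (\<tau> n)) X) \<theta>0)
              \<partial>obs_law n \<theta>0) \<le> ennreal (C * (p n * ln (real n / p n)))) sequentially"
    using good
  proof eventually_elim
    case (elim n)
    then interpret inverse_gaussian b "\<tau> n" by simp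
    show ?case
    proof (rule SUP_least)
      fix \<theta>0 assume \<theta>0: "\<theta>0 \<in> sparse_vectors n (p n)"
      show "(\<integral>\<^sup>+ X. ennreal (sq_dist n (posterior_mean n (ig_density b (\<tau> n)) X) \<theta>0) \<partial>obs_law n \<theta>0)
          \<le> ennreal (C * (p n * ln (real n / p n)))"
        unfolding C_def L_def[symmetric] using elim K_gt \<theta>0
        by (intro order_trans[OF expected_posterior_mean_loss_le] total_risk_le) auto
    qed
  qed
  show ?thesis using tail mean by blast
qed

end
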